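(* Let $A,B,C\in\widehat{\mathbb{F}_q^{*}}$ with $A\neq\varepsilon$ and $(BC)^2\neq A$. Then $$ {}_{3}F_2\!\left(\begin{array}{ccc} A, & B, & C\\ & A\bar{B}, & A\bar{C}\end{array}\Big|\;1\right)_q^{\star}=\begin{cases}0 & \text{if } A \text{ is not a square},\\[4pt] \displaystyle\sum_{R^2=A}\frac{g(\bar{A})\,g(\bar{R}B)\,g(\bar{R}C)\,g(\bar{A}BC)}{g(\bar{R})\,g(\bar{A}B)\,g(\bar{A}C)\,g(\bar{R}BC)} & \text{otherwise.}\end{cases} $$
   Context: Let $q$ be a prime power and $\mathbb{F}_q$ the finite field with $q$ elements. $\widehat{\mathbb{F}_q^{*}}$ denotes the group of multiplicative characters of $\mathbb{F}_q^{*}$; every character $\chi$ (including the trivial character $\varepsilon$) is extended to $\mathbb{F}_q$ by $\chi(0):=0$. $\bar{\chi}$ denotes the inverse character, and juxtaposition denotes pointwise product of characters. Fix a non-trivial additive character $\theta$ of $\mathbb{F}_q$ and define the Gauss sum $g(\chi):=\sum_{x\in\mathbb{F}_q}\chi(x)\theta(x)$. For $A_0,A_1,A_2,B_1,B_2\in\widehat{\mathbb{F}_q^{*}}$ and $x\in\mathbb{F}_q$ define $$ {}_{3}F_2\!\left(\begin{array}{ccc} A_0, & A_1, & A_2\\ & B_1, & B_2\end{array}\Big|\;x\right)_q^{\star}:=\frac{1}{q-1}\sum_{\chi\in\widehat{\mathbb{F}_q^{*}}}\prod_{i=0}^{2}\frac{g(A_i\chi)}{g(A_i)}\prod_{j=1}^{2}\frac{g(\overline{B_j\chi})}{g(\overline{B_j})}\,g(\bar{\chi})\,\chi(-1)\chi(x).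 $$ "$A$ is a square" means $A=S^2$ for some character $S$; $\sum_{R^2=A}$ denotes the sum over all characters $R$ with $R^2=A$.
   Formalization: The formal theorem assumes q odd; for even q the stated identity is false (for q = 4, B = C = ε and A a cubic character, the left side is 2 and the right side is 1). *)

theory Defs
  imports Complex_Main "HOL-Library.FuncSet" "HOL-Library.Function_Division"
    "HOL-Library.Cardinality"
begin

text \<open>
  The field with \<open>q\<close> elements is a type \<open>'a :: {field, finite}\<close>, with \<open>q = CARD('a)\<close>.
  A multiplicative character is represented by its extension by \<open>0\<close> to the whole field, so that
  the product, powers and the inverse of characters are the pointwise operations on functions
  (as \<open>inverse 0 = 0\<close>). The unit of the character group is \<open>triv_char\<close> below and
  not the constant function \<open>1\<close>.
\<close>

definition mult_chars :: "('a :: {field, finite} \<Rightarrow> complex) set" where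
  "mult_chars = {\<chi>. \<chi> 0 = 0 \<and> (\<forall>x. x \<noteq> 0 \<longrightarrow> \<chi> x \<noteq> 0) \<and> (\<forall>x y. \<chi> (x * y) = \<chi> x * \<chi> y)}"

definition triv_char :: "'a :: {field, finite} \<Rightarrow> complex" where
  "triv_char x = (if x = 0 then 0 else 1)"

definition add_chars :: "('a :: {field, finite} \<Rightarrow> complex) set" where
  "add_chars = {\<theta>. (\<forall>x. \<theta> x \<noteq> 0) \<and> (\<forall>x y. \<theta> (x + y) = \<theta> x * \<theta> y)}"

definition gauss_sum ::
    "('a :: {field, finite} \<Rightarrow> complex) \<Rightarrow> ('a \<Rightarrow> complex) \<Rightarrow> complex" where
  "gauss_sum \<theta> \<chi> = (\<Sum>x\<in>UNIV. \<chi> x * \<theta> x)"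

definition is_square_char :: "('a :: {field, finite} \<Rightarrow> complex) \<Rightarrow> bool" where
  "is_square_char A \<longleftrightarrow> (\<exists>S\<in>mult_chars. A = S ^ 2)"

definition hyp3F2 ::
    "('a :: {field, finite} \<Rightarrow> complex) \<Rightarrow> ('a \<Rightarrow> complex) \<Rightarrow> ('a \<Rightarrow> complex) \<Rightarrow> ('a \<Rightarrow> complex)
      \<Rightarrow> ('a \<Rightarrow> complex) \<Rightarrow> ('a \<Rightarrow> complex) \<Rightarrow> 'a \<Rightarrow> complex" where
  "hyp3F2 \<theta> A0 A1 A2 B1 B2 x =
     1 / (of_nat CARD('a) - 1) *
     (\<Sum>\<chi>\<in>mult_chars.
        gauss_sum \<theta> (A0 * \<chi>) / gauss_sum \<theta> A0 *
        (gauss_sum \<theta> (A1 * \<chi>) / gauss_sum \<theta> A1) *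
        (gauss_sum \<theta> (A2 * \<chi>) / gauss_sum \<theta> A2) *
        (gauss_sum \<theta> (inverse (B1 * \<chi>)) / gauss_sum \<theta> (inverse B1)) *
        (gauss_sum \<theta> (inverse (B2 * \<chi>)) / gauss_sum \<theta> (inverse B2)) *
        gauss_sum \<theta> (inverse \<chi>) * \<chi> (-1) * \<chi> x)"

text \<open>
  The well-poised evaluation of \<open>hyp3F2\<close> at \<open>1\<close> is stated for odd \<open>q\<close> only, since it is false in
  characteristic two. For \<open>q = 4\<close> and \<open>\<theta>\<close> the composite of the trace with the non-trivial character
  of the prime field, the Gauss sums are \<open>-1\<close> at the trivial character and \<open>2\<close> at the two others.
  With \<open>B\<close>, \<open>C\<close> trivial and \<open>A\<close> non-trivial the left-hand side is \<open>(-1 + 8 - 1) / 3 = 2\<close>, while the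
  sum over the unique square root \<open>R\<close> of \<open>A\<close> is \<open>1\<close>.
\<close>

text \<open>Finiteness of the character group, so that sums over it are genuine sums.\<close>

lemma mult_chars_one:
  assumes "\<chi> \<in> mult_chars"
  shows "\<chi> 1 = 1"
proof -
  have "\<chi> (1 * 1) = \<chi> 1 * \<chi> 1" and "\<chi> 1 \<noteq> 0"
    using assms unfolding mult_chars_def by (blast, simp)
  then show ?thesis by simp
qed

lemma mult_chars_power:
  assumes "\<chi> \<in> mult_chars"
  shows "\<chi> (x ^ n) = \<chi> x ^ n"
  using assms by (induction n) (simp_all add: mult_chars_one, simp add: mult_chars_def)

lemma finite_mult_chars: "finite (mult_chars :: ('a :: {field, finite} \<Rightarrow> complex) set)"
proof -
  have "\<exists>n>0. x ^ n = 1" if "x \<noteq> 0" for x :: 'a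
  proof -
    have "\<not> inj (\<lambda>n::nat. x ^ n)"
      using finite_imageD[of "\<lambda>n::nat. x ^ n" UNIV] by auto
    then obtain i j :: nat where ij: "i < j" "x ^ i = x ^ j"
      unfolding inj_def by (metis linorder_neqE_nat)
    have "x ^ j = x ^ i * x ^ (j - i)"
      using ij(1) by (simp flip: power_add)
    then have "x ^ (j - i) = 1"
      using ij(2) that by simp
    then show ?thesis using ij(1) by (intro exI[of _ "j - i"]) simp
  qed
  then obtain n :: "'a \<Rightarrow> nat" where n: "\<And>x. x \<noteq> 0 \<Longrightarrow> n x > 0 \<and> x ^ n x = 1"
    by metis
  define V where "V x = (if x = 0 then {0} else {z :: complex. z ^ n x = 1})" for x :: 'a
  have "finite (V x)" for x
    using n[of x] by (auto simp: V_def intro: finite_roots_unity)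
  then have "finite (Pi\<^sub>E UNIV V)"
    by (intro finite_PiE) auto
  moreover have "\<chi> \<in> Pi\<^sub>E UNIV V" if "\<chi> \<in> mult_chars" for \<chi>
  proof -
    have "\<chi> x \<in> V x" for x
    proof (cases "x = 0")
      case True
      then show ?thesis using that by (simp add: V_def mult_chars_def)
    next
      case False
      then have "\<chi> x ^ n x = 1"
        using n[of x] mult_chars_power[OF that, of x "n x"] mult_chars_one[OF that] by simp
      then show ?thesis using False by (simp add: V_def)
    qed
    then show ?thesis by auto
  qed
  ultimately show ?thesis by (meson finite_subset subsetI)
qed

end

theory Submission
  imports Defs "HOL-Algebra.Algebraic_Closure_Type"
begin

text \<open>
  If \<open>A\<close> is not a square then \<open>A (-1) = -1\<close>, and the involution sending \<open>\<chi>\<close> to the inverse of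
  \<open>A \<chi>\<close> changes the sign of every summand. If \<open>A = R\<^sup>2\<close>, shifting \<open>\<chi>\<close> by \<open>R\<close> turns the sum into
  the sum of \<open>\<chi> (-1)\<close> times the products of \<open>g (\<alpha> \<chi>) g (\<alpha> / \<chi>)\<close> over \<open>\<alpha> = a, b, c\<close>, where
  \<open>a = R\<close>, \<open>b = B / R\<close>, \<open>c = C / R\<close>, and for \<open>(a b c)\<^sup>2\<close> non-trivial this equals \<open>q - 1\<close> times
  \<open>g (a b) g (b c) g (a c)\<close> times
  \<open>g a g b g c / g (a b c) + \<phi> (-1) g (a \<phi>) g (b \<phi>) g (c \<phi>) / g (a b c \<phi>)\<close> with \<open>\<phi>\<close> the
  quadratic character.

  To see this, pair the Gauss sums as \<open>g (a \<chi>) g (b / \<chi>)\<close>, \<open>g (b \<chi>) g (c / \<chi>)\<close>, \<open>g (c \<chi>) g (a / \<chi>)\<close>.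
  They become Jacobi sums in \<open>x\<close>, \<open>y\<close>, \<open>z\<close>, and orthogonality in \<open>\<chi>\<close> leaves the sum of \<open>a u b v c w\<close> over the
  surface \<open>x y z = - (1 - x) (1 - y) (1 - z)\<close>, where \<open>u = x (1 - z)\<close>, \<open>v = y (1 - x)\<close>, \<open>w = z (1 - y)\<close>.
  On this surface \<open>u + v + w = 1\<close> and \<open>p = x y z\<close> satisfies \<open>p\<^sup>2 = - u v w\<close>; conversely
  \<open>(u, v, w, p)\<close> determines the point and only three lines are missed, along which the character
  sum vanishes. Counting the square roots of \<open>- u v w\<close> by \<open>1 + \<phi> (- u v w)\<close> gives the two triple
  Jacobi sums. If one of \<open>a b\<close>, \<open>b c\<close>, \<open>a c\<close> is trivial, the reflection formula for
  \<open>g \<chi> g (1 / \<chi>)\<close> evaluates the sum directly.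
\<close>

subsection \<open>The group of multiplicative characters\<close>

lemma mult_chars_zero: "\<chi> \<in> mult_chars \<Longrightarrow> \<chi> 0 = 0"
  and mult_chars_nz: "\<chi> \<in> mult_chars \<Longrightarrow> x \<noteq> 0 \<Longrightarrow> \<chi> x \<noteq> 0"
  and mult_chars_mult: "\<chi> \<in> mult_chars \<Longrightarrow> \<chi> (x * y) = \<chi> x * \<chi> y"
  by (auto simp: mult_chars_def)

lemma mult_chars_eq_0_iff: "\<chi> \<in> mult_chars \<Longrightarrow> \<chi> x = 0 \<longleftrightarrow> x = 0"
  by (auto simp: mult_chars_def)

lemma mult_chars_inverse:
  assumes "\<chi> \<in> mult_chars"
  shows "\<chi> (inverse x) = inverse (\<chi> x)"
proof (cases "x = 0")
  case False
  then have "\<chi> x * \<chi> (inverse x) = 1"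
    using assms by (simp add: mult_chars_one flip: mult_chars_mult)
  then show ?thesis by (metis inverse_unique)
qed (use assms in \<open>simp add: mult_chars_zero\<close>)

lemma mult_chars_divide:
  "\<chi> \<in> mult_chars \<Longrightarrow> \<chi> (x / y) = \<chi> x / \<chi> y"
  by (simp add: divide_inverse mult_chars_mult mult_chars_inverse)

lemma mult_chars_minus:
  "\<chi> \<in> mult_chars \<Longrightarrow> \<chi> (- x) = \<chi> (-1) * \<chi> x"
  by (simp flip: mult_chars_mult)

lemma mult_chars_minus_one_square:
  "\<chi> \<in> mult_chars \<Longrightarrow> \<chi> (-1) * \<chi> (-1) = 1"
  by (simp add: mult_chars_one flip: mult_chars_mult)

lemma mult_chars_minus_one_inverse:
  "\<chi> \<in> mult_chars \<Longrightarrow> inverse (\<chi> (-1)) = \<chi> (-1)"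
  by (simp flip: mult_chars_inverse)

lemma mult_chars_times_closed [intro]:
  "\<chi> \<in> mult_chars \<Longrightarrow> \<psi> \<in> mult_chars \<Longrightarrow> \<chi> * \<psi> \<in> mult_chars"
  by (auto simp: mult_chars_def)

lemma mult_chars_inverse_closed [intro]:
  "\<chi> \<in> mult_chars \<Longrightarrow> inverse \<chi> \<in> mult_chars"
  by (auto simp: mult_chars_def)

lemma triv_char_closed [intro, simp]: "triv_char \<in> mult_chars"
  by (auto simp: mult_chars_def triv_char_def)

lemma triv_char_mult: "\<chi> \<in> mult_chars \<Longrightarrow> triv_char * \<chi> = \<chi>"
  by (auto simp: mult_chars_def triv_char_def fun_eq_iff)

lemma mult_chars_right_inverse: "\<chi> \<in> mult_chars \<Longrightarrow> \<chi> * inverse \<chi> = triv_char"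
  by (auto simp: mult_chars_def triv_char_def fun_eq_iff)

lemma inverse_fun_mult:
  fixes f h :: "'b \<Rightarrow> complex"
  shows "inverse (f * h) = inverse f * inverse h"
  by (simp add: fun_eq_iff)

lemma inverse_fun_inverse:
  fixes f :: "'b \<Rightarrow> complex"
  shows "inverse (inverse f) = f"
  by (simp add: fun_eq_iff)

lemma mult_chars_cancel_left:
  assumes "\<psi> \<in> mult_chars" "\<chi> \<in> mult_chars"
  shows "\<psi> * (inverse \<psi> * \<chi>) = \<chi>" and "inverse \<psi> * (\<psi> * \<chi>) = \<chi>"
  using mult_chars_right_inverse[OF assms(1)] triv_char_mult[OF assms(2)]
  by (simp_all add: mult.commute[of "inverse \<psi>" \<psi>] flip: mult.assoc)

lemma mult_eq_triv_char_iff: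
  assumes "\<psi> \<in> mult_chars" "\<chi> \<in> mult_chars"
  shows "\<psi> * \<chi> = triv_char \<longleftrightarrow> \<chi> = inverse \<psi>"
proof
  assume *: "\<psi> * \<chi> = triv_char"
  show "\<chi> = inverse \<psi>"
  proof
    fix x
    have "\<psi> x * \<chi> x = triv_char x" using * by (simp add: fun_eq_iff)
    then show "\<chi> x = inverse \<psi> x"
      using assms by (cases "x = 0") (auto simp: triv_char_def mult_chars_zero inverse_unique)
  qed
qed (use assms mult_chars_right_inverse in simp)

lemma sum_mult_chars_shift:
  assumes "\<psi> \<in> mult_chars"
  shows "(\<Sum>\<chi>\<in>mult_chars. f (\<psi> * \<chi>)) = (\<Sum>\<chi>\<in>mult_chars. f \<chi>)"
  by (rule sum.reindex_bij_witness[of _ "\<lambda>\<chi>. inverse \<psi> * \<chi>" "\<lambda>\<chi>. \<psi> * \<chi>"])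
     (use assms mult_chars_cancel_left in auto)

lemma sum_mult_chars_inverse:
  "(\<Sum>\<chi>\<in>mult_chars. f (inverse \<chi>)) = (\<Sum>\<chi>\<in>mult_chars. f \<chi>)"
  by (rule sum.reindex_bij_witness[of _ inverse inverse])
     (auto simp: inverse_fun_inverse)

text \<open>Scaling the summation variable by some \<open>t\<close> with
  \<open>\<chi> t \<noteq> 1\<close> permutes the terms and multiplies the sum by
  \<open>\<chi> t\<close>.\<close>

lemma sum_mult_char:
  fixes \<chi> :: "'a :: {field, finite} \<Rightarrow> complex"
  assumes "\<chi> \<in> mult_chars" "\<chi> \<noteq> triv_char"
  shows "(\<Sum>x\<in>UNIV. \<chi> x) = 0"
proof -
  obtain t where t: "t \<noteq> 0" "\<chi> t \<noteq> 1"
    using assms by (auto simp: fun_eq_iff triv_char_def mult_chars_zero split: if_splits)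
  have "(\<Sum>x\<in>UNIV. \<chi> x) = (\<Sum>x\<in>UNIV. \<chi> (t * x))"
    by (rule sum.reindex_bij_witness[of _ "\<lambda>x. t * x" "\<lambda>x. x / t"]) (use t in auto)
  also have "\<dots> = \<chi> t * (\<Sum>x\<in>UNIV. \<chi> x)"
    using assms by (simp add: mult_chars_mult sum_distrib_left)
  finally show ?thesis using t by (simp add: algebra_simps)
qed

lemma sum_triv_char:
  "(\<Sum>x\<in>(UNIV :: 'a :: {field, finite} set). triv_char x) = of_nat CARD('a) - 1"
proof -
  have "(\<Sum>x\<in>(UNIV :: 'a set). triv_char x) = (\<Sum>x\<in>UNIV - {0::'a}. 1)"
    by (intro sum.mono_neutral_cong_right) (auto simp: triv_char_def)
  also have "\<dots> = of_nat (CARD('a) - 1)" by (simp add: card_Diff_subset)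
  also have "\<dots> = of_nat CARD('a) - 1" using zero_less_card_finite[where 'a='a]
    by (simp add: of_nat_diff)
  finally show ?thesis .
qed

subsection \<open>A generator of the multiplicative group\<close>

lemma card_field_gt_1: "CARD('a :: {field, finite}) > 1"
proof -
  have "card {0, 1 :: 'a} \<le> CARD('a)" by (intro card_mono) auto
  then show ?thesis by simp
qed

text \<open>Multiplication by \<open>x\<close> permutes the nonzero elements, so their product is
  unchanged although each of its \<open>CARD('a) - 1\<close> factors gains an
  \<open>x\<close>.\<close>

lemma power_card_minus_one:
  fixes x :: "'a :: {field, finite}"
  assumes "x \<noteq> 0"
  shows "x ^ (CARD('a) - 1) = 1"
proof -
  have "(\<Prod>y\<in>UNIV - {0}. y) = (\<Prod>y\<in>UNIV - {0}. x * y)"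
    by (rule prod.reindex_bij_witness[of _ "\<lambda>y. x * y" "\<lambda>y. y / x"]) (use assms in auto)
  also have "\<dots> = x ^ (CARD('a) - 1) * (\<Prod>y\<in>UNIV - {0}. y)"
    by (simp add: prod.distrib card_Diff_subset)
  finally show ?thesis by auto
qed

text \<open>A generator of the cyclic group of units. Characters are handled through their single
  value at it, which may be any complex \<open>z\<close> with
  \<open>z ^ (CARD('a) - 1) = 1\<close>.\<close>

definition field_gen :: "'a :: {field, finite}" where
  "field_gen = (SOME g. g \<noteq> 0 \<and> (\<forall>x. x \<noteq> 0 \<longrightarrow> (\<exists>i::nat. x = g ^ i)))"

lemma field_gen_nz: "(field_gen :: 'a :: {field, finite}) \<noteq> 0"
  and field_gen_surj: "(x :: 'a) \<noteq> 0 \<Longrightarrow> \<exists>i::nat. x = field_gen ^ i"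
proof -
  \<comment> \<open>The type is repackaged as a ring with a carrier, so that the cyclicity of the
    unit group of a finite field can be quoted.\<close>
  define K where "K = (ring_of_type_algebra :: 'a ring)"
  interpret K: field K unfolding K_def by rule
  have pow: "y [^]\<^bsub>K\<^esub> i = y ^ i" for y :: 'a and i :: nat
    by (induction i) (auto simp: K_def ring_of_type_algebra_def mult_ac)
  have carr: "carrier (Multiplicative_Group.mult_of K) = UNIV - {0}"
    by (simp add: K_def ring_of_type_algebra_def)
  have "\<exists>a\<in>carrier (Multiplicative_Group.mult_of K).
      carrier (Multiplicative_Group.mult_of K) = {a [^]\<^bsub>K\<^esub> i | i::nat. i \<in> UNIV}"
    by (rule K.finite_field_mult_group_has_gen) (simp add: K_def ring_of_type_algebra_def)
  then obtain a :: 'a where a: "a \<in> UNIV - {0}" "UNIV - {0} = {a ^ i | i::nat. i \<in> UNIV}"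
    unfolding pow carr by blast
  have "\<exists>i::nat. x = a ^ i" if "x \<noteq> 0" for x
  proof -
    have "x \<in> UNIV - {0}" using that by simp
    then show ?thesis unfolding a(2) by simp
  qed
  then have "\<exists>g::'a. g \<noteq> 0 \<and> (\<forall>x. x \<noteq> 0 \<longrightarrow> (\<exists>i::nat. x = g ^ i))"
    using a(1) by (intro exI[of _ a]) simp
  note gen = someI_ex[OF this, folded field_gen_def]
  show "(field_gen :: 'a) \<noteq> 0" by (rule conjunct1[OF gen])
  show "\<exists>i::nat. x = field_gen ^ i" if "x \<noteq> 0" for x :: 'a
    using gen that by simp
qed

lemma power_mod_of_power_eq_1:
  fixes x :: "'b :: monoid_mult"
  assumes "x ^ n = 1"
  shows "x ^ (i mod n) = x ^ i"
proof -
  have "x ^ (n * (i div n) + i mod n) = x ^ (i mod n)"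
    unfolding power_add power_mult assms by simp
  then show ?thesis by simp
qed

lemma field_gen_power_mod:
  "(field_gen :: 'a :: {field, finite}) ^ (i mod (CARD('a) - 1)) = field_gen ^ i"
  by (rule power_mod_of_power_eq_1[OF power_card_minus_one[OF field_gen_nz]])

text \<open>The powers with exponent below \<open>CARD('a) - 1\<close> already cover all
  \<open>CARD('a) - 1\<close> units, so by counting they are distinct.\<close>

lemma field_gen_power_eq_iff:
  "(field_gen :: 'a :: {field, finite}) ^ i = field_gen ^ j \<longleftrightarrow>
     i mod (CARD('a) - 1) = j mod (CARD('a) - 1)"
proof -
  let ?n = "CARD('a) - 1" and ?g = "field_gen :: 'a"
  have n: "?n > 0" using card_field_gt_1[where 'a='a] by simp
  have "UNIV - {0} \<subseteq> (\<lambda>i. ?g ^ i) ` {..<?n}"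
  proof
    fix x :: 'a assume "x \<in> UNIV - {0}"
    then obtain i :: nat where "x = ?g ^ i" using field_gen_surj[of x] by auto
    then show "x \<in> (\<lambda>i. ?g ^ i) ` {..<?n}"
      using n by (intro image_eqI[of _ _ "i mod ?n"]) (simp_all add: field_gen_power_mod del: One_nat_def)
  qed
  then have "card {..<?n} \<le> card ((\<lambda>i. ?g ^ i) ` {..<?n})"
    using card_mono[of "(\<lambda>i. ?g ^ i) ` {..<?n}" "UNIV - {0::'a}"] by (simp add: card_Diff_subset)
  then have inj: "inj_on (\<lambda>i. ?g ^ i) {..<?n}"
    by (intro eq_card_imp_inj_on antisym card_image_le) auto
  show ?thesis
  proof
    assume "?g ^ i = ?g ^ j"
    then have "?g ^ (i mod ?n) = ?g ^ (j mod ?n)" by (simp only: field_gen_power_mod)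
    then show "i mod ?n = j mod ?n" using inj n by (auto simp: inj_on_def)
  next
    assume "i mod ?n = j mod ?n"
    then show "?g ^ i = ?g ^ j" using field_gen_power_mod[where 'a='a] by metis
  qed
qed

text \<open>The character sends \<open>field_gen ^ i\<close> to \<open>z ^ i\<close>. The exponent
  picked by \<open>SOME\<close> does not matter: it is determined modulo
  \<open>CARD('a) - 1\<close>, and by \<open>z\<close> being a root of unity that is all
  \<open>z ^ i\<close> depends on.\<close>

lemma ex_mult_char_field_gen:
  assumes z: "z ^ (CARD('a) - 1) = (1 :: complex)"
  shows "\<exists>\<chi>\<in>mult_chars. \<chi> (field_gen :: 'a :: {field, finite}) = z"
proof -
  let ?g = "field_gen :: 'a"
  define \<chi> where "\<chi> x = (if x = 0 then 0 else z ^ (SOME i. ?g ^ i = x))" for x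
  have \<chi>: "\<chi> (?g ^ i) = z ^ i" for i
  proof -
    have "?g ^ (SOME j. ?g ^ j = ?g ^ i) = ?g ^ i" by (rule someI_ex) auto
    then have "z ^ (SOME j. ?g ^ j = ?g ^ i) = z ^ i"
      unfolding field_gen_power_eq_iff by (metis power_mod_of_power_eq_1[OF z])
    then show ?thesis by (simp add: \<chi>_def field_gen_nz)
  qed
  have "z \<noteq> 0" using z card_field_gt_1[where 'a='a] by (auto simp: power_0_left)
  have "\<chi> (x * y) = \<chi> x * \<chi> y" for x y
  proof (cases "x = 0 \<or> y = 0")
    case False
    then obtain i j where "x = ?g ^ i" "y = ?g ^ j" using field_gen_surj[of x] field_gen_surj[of y] by auto
    then show ?thesis using \<chi> by (simp flip: power_add)
  qed (auto simp: \<chi>_def)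
  then have "\<chi> \<in> mult_chars"
    using \<open>z \<noteq> 0\<close> by (simp add: mult_chars_def) (simp add: \<chi>_def)
  then show ?thesis using \<chi>[of 1] by auto
qed

lemma mult_chars_eqI:
  fixes \<chi> \<psi> :: "'a :: {field, finite} \<Rightarrow> complex"
  assumes "\<chi> \<in> mult_chars" "\<psi> \<in> mult_chars" "\<chi> field_gen = \<psi> field_gen"
  shows "\<chi> = \<psi>"
proof
  fix x
  show "\<chi> x = \<psi> x"
    using field_gen_surj[of x] assms by (cases "x = 0") (auto simp: mult_chars_zero mult_chars_power)
qed

lemma mult_chars_field_gen_root_unity:
  fixes \<chi> :: "'a :: {field, finite} \<Rightarrow> complex"
  assumes "\<chi> \<in> mult_chars"
  shows "\<chi> field_gen ^ (CARD('a) - 1) = 1"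
  using mult_chars_power[OF assms, of field_gen "CARD('a) - 1"] mult_chars_one[OF assms]
  by (simp only: power_card_minus_one[OF field_gen_nz])

lemma bij_betw_mult_chars_roots_unity:
  "bij_betw (\<lambda>\<chi>. \<chi> field_gen) (mult_chars :: ('a :: {field, finite} \<Rightarrow> complex) set)
     {z. z ^ (CARD('a) - 1) = 1}"
  unfolding bij_betw_def
proof (intro conjI inj_onI equalityI subsetI)
  fix z assume "z \<in> {z :: complex. z ^ (CARD('a) - 1) = 1}"
  then show "z \<in> (\<lambda>\<chi>. \<chi> field_gen) ` (mult_chars :: ('a \<Rightarrow> complex) set)"
    using ex_mult_char_field_gen[where 'a='a, of z] by (auto simp: image_iff)
qed (auto intro: mult_chars_eqI mult_chars_field_gen_root_unity simp del: One_nat_def)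

lemma card_mult_chars:
  "card (mult_chars :: ('a :: {field, finite} \<Rightarrow> complex) set) = CARD('a) - 1"
  using bij_betw_same_card[OF bij_betw_mult_chars_roots_unity[where 'a='a]]
    card_roots_unity_eq[of "CARD('a) - 1"] card_field_gt_1[where 'a='a] by simp

text \<open>The character sending the generator to a primitive root of unity of order
  \<open>CARD('a) - 1\<close> is injective on units: \<open>x\<close> is a power of the generator
  with exponent strictly between 0 and that order.\<close>

lemma ex_mult_char_neq_1:
  fixes x :: "'a :: {field, finite}"
  assumes "x \<noteq> 0" "x \<noteq> 1"
  shows "\<exists>\<chi>\<in>mult_chars. \<chi> x \<noteq> 1"
proof -
  define n where "n = CARD('a) - 1"
  have n: "n > 0" using card_field_gt_1[where 'a='a] by (simp add: n_def)
  obtain i where i: "x = field_gen ^ i" using field_gen_surj assms by blast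
  define k where "k = i mod n"
  have k: "x = field_gen ^ k" using i by (simp only: k_def n_def field_gen_power_mod)
  have "k < n" "k \<noteq> 0" using n k assms by (auto simp: k_def intro: Nat.gr0I)
  define z where "z = cis (2 * pi * 1 / n)"
  have z: "z ^ n = 1" using n by (simp add: z_def DeMoivre)
  have "z ^ k \<noteq> 1"
  proof
    assume "z ^ k = 1"
    then have "cis (2 * pi * real k / real n) = cis (2 * pi * real 0 / real n)"
      by (simp add: z_def DeMoivre mult_ac)
    moreover have "inj_on (\<lambda>k. cis (2 * pi * real k / real n)) {..<n}"
      using bij_betw_roots_unity[OF n] by (simp add: bij_betw_def)
    ultimately show False using \<open>k < n\<close> \<open>k \<noteq> 0\<close> n by (auto simp: inj_on_def)
  qed
  moreover obtain \<chi> where "\<chi> \<in> mult_chars" "\<chi> (field_gen :: 'a) = z"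
    using ex_mult_char_field_gen[where 'a='a, of z] z by (auto simp: n_def)
  ultimately show ?thesis
    using k by (auto simp: mult_chars_power)
qed

text \<open>Dual to \<open>sum_mult_char\<close>: for a unit \<open>x\<close> other than 1, shifting
  by a character \<open>\<psi>\<close> with \<open>\<psi> x \<noteq> 1\<close> multiplies the sum by
  \<open>\<psi> x\<close>. At 0 every summand vanishes, a default on which later degenerate
  quotients rely.\<close>

lemma sum_mult_chars_orthogonal:
  fixes x :: "'a :: {field, finite}"
  shows "(\<Sum>\<chi>\<in>mult_chars. \<chi> x) = (if x = 1 then of_nat CARD('a) - 1 else 0)"
proof (cases "x = 1")
  case True
  have "(\<Sum>\<chi>\<in>mult_chars. \<chi> (1::'a)) = (\<Sum>\<chi>\<in>(mult_chars :: ('a \<Rightarrow> complex) set). 1)"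
    by (intro sum.cong) (auto simp: mult_chars_one)
  then show ?thesis using True card_field_gt_1[where 'a='a] by (simp add: card_mult_chars of_nat_diff)
next
  case False
  show ?thesis
  proof (cases "x = 0")
    case True
    then show ?thesis by (auto intro!: sum.neutral simp: mult_chars_zero)
  next
    case nz: False
    obtain \<psi> where \<psi>: "\<psi> \<in> mult_chars" "\<psi> x \<noteq> 1"
      using ex_mult_char_neq_1 nz False by blast
    have "(\<Sum>\<chi>\<in>mult_chars. \<chi> x) = (\<Sum>\<chi>\<in>mult_chars. (\<psi> * \<chi>) x)"
      using sum_mult_chars_shift[OF \<psi>(1), of "\<lambda>\<chi>. \<chi> x"] by simp
    also have "\<dots> = \<psi> x * (\<Sum>\<chi>\<in>mult_chars. \<chi> x)" by (simp add: sum_distrib_left)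
    finally show ?thesis using False \<psi> by (simp add: algebra_simps)
  qed
qed

subsection \<open>The quadratic character\<close>

text \<open>In even characteristic no such character exists and the choice is arbitrary.\<close>

definition quad_char :: "'a :: {field, finite} \<Rightarrow> complex" where
  "quad_char = (SOME \<chi>. \<chi> \<in> mult_chars \<and> \<chi> field_gen = -1)"

lemma
  assumes "odd CARD('a :: {field, finite})"
  shows quad_char_closed: "(quad_char :: 'a \<Rightarrow> complex) \<in> mult_chars"
    and quad_char_field_gen: "quad_char (field_gen :: 'a) = -1"
proof -
  have "(-1 :: complex) ^ (CARD('a) - 1) = 1" using assms by simp
  then have "\<exists>\<chi> :: 'a \<Rightarrow> complex. \<chi> \<in> mult_chars \<and> \<chi> field_gen = -1"
    using ex_mult_char_field_gen[where 'a='a, of "-1"] by blast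
  from someI_ex[OF this] show "(quad_char :: 'a \<Rightarrow> complex) \<in> mult_chars"
    and "quad_char (field_gen :: 'a) = -1" by (simp_all add: quad_char_def)
qed

text \<open>The half power squares to 1 without being 1, hence is -1. That -1 differs from 1 then
  comes for free, so the characteristic never has to be computed.\<close>

lemma field_gen_half_power:
  assumes "odd CARD('a :: {field, finite})"
  shows "(field_gen :: 'a) ^ ((CARD('a) - 1) div 2) = -1" and "(-1 :: 'a) \<noteq> 1"
proof -
  define n where "n = CARD('a) - 1"
  have n: "even n" "n > 0" using assms card_field_gt_1[where 'a='a] by (auto simp: n_def)
  have "(field_gen :: 'a) ^ n = 1" by (simp only: n_def power_card_minus_one[OF field_gen_nz])
  then have "((field_gen :: 'a) ^ (n div 2)) ^ 2 = 1" using n by (simp flip: power_mult)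
  moreover have neq: "(field_gen :: 'a) ^ (n div 2) \<noteq> 1"
  proof
    assume "(field_gen :: 'a) ^ (n div 2) = 1"
    then have "(n div 2) mod n = 0"
      using field_gen_power_eq_iff[where 'a='a, of "n div 2" 0] by (simp add: n_def)
    then have "n div 2 = 0" using n by simp
    then show False using n by (auto simp: div_eq_0_iff less_2_cases_iff)
  qed
  ultimately have eq: "(field_gen :: 'a) ^ (n div 2) = -1" by (auto simp: power2_eq_1_iff)
  then show "(field_gen :: 'a) ^ ((CARD('a) - 1) div 2) = -1" by (simp add: n_def)
  show "(-1 :: 'a) \<noteq> 1" using neq eq by simp
qed

lemma two_neq_zero:
  assumes "odd CARD('a :: {field, finite})"
  shows "(2 :: 'a) \<noteq> 0"
  using field_gen_half_power(2)[OF assms] by (metis add_eq_0_iff one_add_one)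

lemma quad_char_square:
  assumes "odd CARD('a :: {field, finite})"
  shows "quad_char * quad_char = (triv_char :: 'a \<Rightarrow> complex)"
  by (rule mult_chars_eqI)
     (use assms in \<open>auto simp: quad_char_closed quad_char_field_gen triv_char_def field_gen_nz\<close>)

text \<open>For an even exponent of \<open>t\<close> there are two roots \<open>r\<close> and
  \<open>- r\<close>, distinct because 2 is nonzero. For an odd one there is none, since the
  quadratic character is 1 on nonzero squares but -1 at \<open>t\<close>.\<close>

lemma card_square_roots:
  fixes t :: "'a :: {field, finite}"
  assumes "odd CARD('a)" "t \<noteq> 0"
  shows "of_nat (card {p. p ^ 2 = t}) = 1 + quad_char t"
proof -
  note \<phi> = quad_char_closed[OF assms(1)] quad_char_field_gen[OF assms(1)]
  obtain i where i: "t = field_gen ^ i" using field_gen_surj assms by blast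
  have t: "quad_char t = (-1) ^ i" using \<phi> by (simp add: i mult_chars_power)
  show ?thesis
  proof (cases "even i")
    case True
    define r where "r = (field_gen :: 'a) ^ (i div 2)"
    have r: "r ^ 2 = t" using True by (simp add: r_def i flip: power_mult)
    have "r \<noteq> 0" by (simp add: r_def field_gen_nz)
    have "{p. p ^ 2 = t} = {r, - r}" unfolding r[symmetric] by (auto simp: power2_eq_iff)
    moreover have "r \<noteq> - r"
    proof
      assume "r = - r"
      then have "2 * r = 0" by (simp add: eq_neg_iff_add_eq_0)
      then show False using \<open>r \<noteq> 0\<close> two_neq_zero[OF assms(1)] by simp
    qed
    ultimately show ?thesis using True t by simp
  next
    case False
    have "{p. p ^ 2 = t} = {}"
    proof safe
      fix p assume "t = p ^ 2"
      then have "p \<noteq> 0" using assms by auto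
      then obtain j where "p = field_gen ^ j" using field_gen_surj by blast
      then have "quad_char t = ((-1) ^ j) ^ 2"
        using \<phi> by (simp add: \<open>t = p ^ 2\<close> mult_chars_power)
      then have "quad_char t = 1" by (cases "even j") auto
      then show "p \<in> {}" using t False by simp
    qed
    then show ?thesis using False t by simp
  qed
qed

text \<open>If \<open>A (-1) = 1\<close>, a complex square root of \<open>A field_gen\<close> is
  again an admissible value at the generator: its power with exponent \<open>CARD('a) - 1\<close> is
  \<open>A\<close> at the half power of the generator, that is \<open>A (-1)\<close>. It therefore
  defines a square root of \<open>A\<close>.\<close>

lemma mult_char_minus_one_nonsquare:
  fixes A :: "'a :: {field, finite} \<Rightarrow> complex"
  assumes "odd CARD('a)" "A \<in> mult_chars" "\<not> is_square_char A"
  shows "A (-1) = -1"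
proof (rule ccontr)
  assume "A (-1) \<noteq> -1"
  moreover have "A (-1) ^ 2 = 1"
    using mult_chars_minus_one_square[OF assms(2)] by (simp add: power2_eq_square)
  ultimately have A: "A (-1) = 1" by (auto simp: power2_eq_1_iff)
  define n where "n = CARD('a) - 1"
  have n: "even n" using assms by (simp add: n_def)
  define z where "z = csqrt (A field_gen)"
  have "z ^ n = (z ^ 2) ^ (n div 2)" using n by (simp flip: power_mult)
  also have "\<dots> = A (field_gen ^ (n div 2))" using assms(2) by (simp add: z_def mult_chars_power)
  also have "\<dots> = 1" using A by (simp only: n_def field_gen_half_power(1)[OF assms(1)])
  finally obtain S where S: "S \<in> mult_chars" "S (field_gen :: 'a) = z"
    using ex_mult_char_field_gen[where 'a='a, of z] by (auto simp: n_def)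
  have "A = S * S"
    by (rule mult_chars_eqI)
       (use S assms(2) in \<open>auto simp: z_def power2_csqrt[unfolded power2_eq_square]\<close>)
  then have "A = S ^ 2" by (simp add: power2_eq_square)
  then show False using S assms(3) by (auto simp: is_square_char_def)
qed

text \<open>Two characters with equal squares agree up to a sign at the generator, and the sign -1
  is contributed by the quadratic character.\<close>

lemma mult_chars_square_roots:
  fixes R :: "'a :: {field, finite} \<Rightarrow> complex"
  assumes "odd CARD('a)" "R \<in> mult_chars"
  shows "{S. S \<in> mult_chars \<and> S ^ 2 = R ^ 2} = {R, R * quad_char}"
    and "R \<noteq> R * quad_char"
proof -
  note \<phi> = quad_char_closed[OF assms(1)] quad_char_field_gen[OF assms(1)]
  show "R \<noteq> R * quad_char"
  proof
    assume "R = R * quad_char"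
    then have "R field_gen = - R field_gen" using \<phi>(2) by (metis mult_minus1_right times_fun_apply)
    then show False using mult_chars_nz[OF assms(2) field_gen_nz] by simp
  qed
  have "S = R \<or> S = R * quad_char" if S: "S \<in> mult_chars" "S ^ 2 = R ^ 2" for S
  proof -
    have "S field_gen ^ 2 = R field_gen ^ 2"
      using S(2) by (metis power2_eq_square times_fun_apply)
    then have "S field_gen = R field_gen \<or> S field_gen = (R * quad_char) field_gen"
      using \<phi> by (simp add: power2_eq_iff)
    then show ?thesis using S assms \<phi> by (blast intro: mult_chars_eqI)
  qed
  moreover have "(R * quad_char) ^ 2 = R ^ 2"
  proof -
    have "(R * quad_char) ^ 2 = (quad_char * quad_char) * (R * R)"
      by (simp add: power2_eq_square mult_ac)
    then show ?thesis using assms quad_char_square[OF assms(1)] triv_char_mult[of "R * R"]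
      by (simp add: power2_eq_square mult_chars_times_closed)
  qed
  ultimately show "{S. S \<in> mult_chars \<and> S ^ 2 = R ^ 2} = {R, R * quad_char}"
    using assms \<phi> by auto
qed

subsection \<open>Gauss and Jacobi sums\<close>

locale nontrivial_add_char =
  fixes \<theta> :: "'a :: {field, finite} \<Rightarrow> complex"
  assumes add_char: "\<theta> \<in> add_chars" and nontrivial: "\<exists>x. \<theta> x \<noteq> 1"
begin

abbreviation g :: "('a \<Rightarrow> complex) \<Rightarrow> complex" where
  "g \<equiv> gauss_sum \<theta>"

lemma add_char_add: "\<theta> (x + y) = \<theta> x * \<theta> y"
  using add_char by (simp add: add_chars_def)

lemma add_char_zero: "\<theta> 0 = 1"
proof -
  have "\<theta> 0 * \<theta> 0 = \<theta> 0 * 1" "\<theta> 0 \<noteq> 0"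
    using add_char add_char_add[of 0 0] by (simp_all add: add_chars_def)
  then show ?thesis by (metis mult_left_cancel)
qed

lemma sum_add_char: "(\<Sum>x\<in>UNIV. \<theta> x) = 0"
proof -
  obtain t where t: "\<theta> t \<noteq> 1" using nontrivial by blast
  have "(\<Sum>x\<in>UNIV. \<theta> x) = (\<Sum>x\<in>UNIV. \<theta> (t + x))"
    by (rule sum.reindex_bij_witness[of _ "\<lambda>x. t + x" "\<lambda>x. x - t"]) auto
  also have "\<dots> = \<theta> t * (\<Sum>x\<in>UNIV. \<theta> x)"
    by (simp add: add_char_add sum_distrib_left)
  finally show ?thesis using t by (simp add: algebra_simps)
qed

lemma sum_add_char_scaled: "(\<Sum>y\<in>UNIV. \<theta> (s * y)) = (if s = 0 then of_nat CARD('a) else 0)"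
proof (cases "s = 0")
  case False
  have "(\<Sum>y\<in>UNIV. \<theta> (s * y)) = (\<Sum>y\<in>UNIV. \<theta> y)"
    by (rule sum.reindex_bij_witness[of _ "\<lambda>x. x / s" "\<lambda>x. s * x"]) (use False in auto)
  then show ?thesis using False by (simp add: sum_add_char)
qed (simp add: add_char_zero)

lemma gauss_sum_triv: "g triv_char = -1"
proof -
  have "g triv_char = (\<Sum>x\<in>UNIV - {0}. \<theta> x)"
    unfolding gauss_sum_def by (intro sum.mono_neutral_cong_right) (auto simp: triv_char_def)
  also have "\<dots> = (\<Sum>x\<in>UNIV. \<theta> x) - \<theta> 0"
    by (subst sum.remove[of UNIV 0]) auto
  finally show ?thesis by (simp add: sum_add_char add_char_zero)
qed

text \<open>Substituting \<open>x = t * y\<close> for each nonzero \<open>y\<close> leaves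
  \<open>\<chi> t * \<theta> ((t + 1) * y)\<close>. Summed over all \<open>y\<close> this survives
  only at \<open>t = -1\<close>; the extra term \<open>y = 0\<close> has to be subtracted again and
  is the sum of \<open>\<chi>\<close>, which is nonzero only for the trivial character.\<close>

lemma gauss_sum_mult_inverse:
  assumes \<chi>: "\<chi> \<in> mult_chars"
  shows "g \<chi> * g (inverse \<chi>) = of_nat CARD('a) * \<chi> (-1) - (if \<chi> = triv_char then of_nat CARD('a) - 1 else 0)"
proof -
  have inner: "(\<Sum>x\<in>UNIV. \<chi> x * \<theta> x * (inverse \<chi> y * \<theta> y)) = (\<Sum>t\<in>UNIV. \<chi> t * \<theta> ((t + 1) * y))"
    if "y \<noteq> 0" for y
  proof -
    have "(\<Sum>x\<in>UNIV. \<chi> x * \<theta> x * (inverse \<chi> y * \<theta> y)) =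
        (\<Sum>t\<in>UNIV. \<chi> (t * y) * \<theta> (t * y) * (inverse \<chi> y * \<theta> y))"
      by (rule sum.reindex_bij_witness[of _ "\<lambda>t. t * y" "\<lambda>x. x / y"]) (use that in auto)
    also have "\<dots> = (\<Sum>t\<in>UNIV. \<chi> t * \<theta> ((t + 1) * y))"
      using mult_chars_nz[OF \<chi> that]
      by (intro sum.cong refl) (simp add: mult_chars_mult[OF \<chi>] add_char_add distrib_right)
    finally show ?thesis .
  qed
  have "g \<chi> * g (inverse \<chi>) = (\<Sum>y\<in>UNIV. \<Sum>x\<in>UNIV. \<chi> x * \<theta> x * (inverse \<chi> y * \<theta> y))"
    unfolding gauss_sum_def sum_product by (rule sum.swap)
  also have "\<dots> = (\<Sum>y\<in>UNIV - {0}. \<Sum>t\<in>UNIV. \<chi> t * \<theta> ((t + 1) * y))"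
    by (rule sum.mono_neutral_cong_right) (use \<chi> inner in \<open>auto simp: mult_chars_zero\<close>)
  also have "\<dots> = (\<Sum>y\<in>UNIV. \<Sum>t\<in>UNIV. \<chi> t * \<theta> ((t + 1) * y)) - (\<Sum>t\<in>UNIV. \<chi> t)"
    by (subst sum.remove[of UNIV 0]) (auto simp: add_char_zero)
  also have "(\<Sum>y\<in>UNIV. \<Sum>t\<in>UNIV. \<chi> t * \<theta> ((t + 1) * y)) =
      (\<Sum>t\<in>UNIV. \<chi> t * (\<Sum>y\<in>UNIV. \<theta> ((t + 1) * y)))"
    by (subst sum.swap) (simp add: sum_distrib_left)
  also have "\<dots> = (\<Sum>t\<in>(UNIV :: 'a set). if t = -1 then of_nat CARD('a) * \<chi> (-1) else 0)"
    by (intro sum.cong[OF refl]) (auto simp: sum_add_char_scaled simp flip: eq_neg_iff_add_eq_0)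
  also have "\<dots> = of_nat CARD('a) * \<chi> (-1)" by simp
  also have "(\<Sum>t\<in>UNIV. \<chi> t) = (if \<chi> = triv_char then of_nat CARD('a) - 1 else 0)"
    using \<chi> by (simp add: sum_mult_char sum_triv_char)
  finally show ?thesis .
qed

lemma q_neq: "(of_nat CARD('a) :: complex) \<noteq> 0" "(of_nat CARD('a) :: complex) - 1 \<noteq> 0"
proof -
  have "CARD('a) \<noteq> 0" "CARD('a) \<noteq> 1" using card_field_gt_1[where 'a='a] by linarith+
  then show "(of_nat CARD('a) :: complex) \<noteq> 0" "(of_nat CARD('a) :: complex) - 1 \<noteq> 0"
    unfolding right_minus_eq of_nat_eq_1_iff of_nat_eq_0_iff by blast+
qed

lemma gauss_sum_nz:
  assumes "\<chi> \<in> mult_chars"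
  shows "g \<chi> \<noteq> 0"
proof (cases "\<chi> = triv_char")
  case False
  then have "g \<chi> * g (inverse \<chi>) \<noteq> 0"
    using gauss_sum_mult_inverse[OF assms] q_neq mult_chars_nz[OF assms, of "-1"] by auto
  then show ?thesis by auto
qed (simp add: gauss_sum_triv)

text \<open>Homogeneity forces \<open>f\<close> to be \<open>f 1\<close> times
  \<open>\<chi>\<close>. At 0 this uses that \<chi> is nontrivial: \<open>f 0\<close> equals
  \<open>\<chi> t * f 0\<close> for some \<open>t\<close> with \<open>\<chi> t \<noteq> 1\<close>.
  It is applied to the multiplicative convolutions that arise from products of Gauss sums.\<close>

lemma sum_homogeneous_add_char:
  assumes \<chi>: "\<chi> \<in> mult_chars" "\<chi> \<noteq> triv_char"
    and hom: "\<And>t s. t \<noteq> 0 \<Longrightarrow> f (t * s) = \<chi> t * f s"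
  shows "(\<Sum>s\<in>UNIV. f s * \<theta> s) = f 1 * g \<chi>"
proof -
  obtain t where t: "t \<noteq> 0" "\<chi> t \<noteq> 1"
    using \<chi> by (auto simp: fun_eq_iff triv_char_def mult_chars_zero split: if_splits)
  then have "f 0 = 0" using hom[of t 0] by simp
  then have f: "f s = f 1 * \<chi> s" for s
    using hom[of s 1] \<chi> by (cases "s = 0") (auto simp: mult_chars_zero)
  have "(\<Sum>s\<in>UNIV. f s * \<theta> s) = (\<Sum>s\<in>UNIV. f 1 * \<chi> s * \<theta> s)"
    by (intro sum.cong refl arg_cong2[where f = "(*)"] f)
  then show ?thesis by (simp add: gauss_sum_def sum_distrib_left mult_ac)
qed

text \<open>Collecting the double sum by \<open>s = x + y\<close> gives as coefficient of
  \<open>\<theta> s\<close> a convolution that is homogeneous for \<open>\<alpha> * \<beta>\<close>;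
  its value at 1 is the Jacobi sum.\<close>

lemma gauss_sum_mult_jacobi:
  assumes "\<alpha> \<in> mult_chars" "\<beta> \<in> mult_chars" "\<alpha> * \<beta> \<noteq> triv_char"
  shows "g \<alpha> * g \<beta> = g (\<alpha> * \<beta>) * (\<Sum>x\<in>UNIV. \<alpha> x * \<beta> (1 - x))"
proof -
  define f where "f s = (\<Sum>x\<in>UNIV. \<alpha> x * \<beta> (s - x))" for s
  have hom: "f (t * s) = (\<alpha> * \<beta>) t * f s" if "t \<noteq> 0" for t s
  proof -
    have "f (t * s) = (\<Sum>x\<in>UNIV. \<alpha> (t * x) * \<beta> (t * s - t * x))" unfolding f_def
      by (rule sum.reindex_bij_witness[of _ "\<lambda>x. t * x" "\<lambda>x. x / t"]) (use that in auto)
    then show ?thesis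
      using assms
      by (simp add: f_def sum_distrib_left mult_chars_mult flip: right_diff_distrib) (simp add: mult_ac)
  qed
  have "g \<alpha> * g \<beta> = (\<Sum>x\<in>UNIV. \<Sum>y\<in>UNIV. \<alpha> x * \<theta> x * (\<beta> y * \<theta> y))"
    unfolding gauss_sum_def sum_product by simp
  also have "\<dots> = (\<Sum>x\<in>UNIV. \<Sum>s\<in>UNIV. \<alpha> x * \<beta> (s - x) * \<theta> s)"
  proof (rule sum.cong[OF refl])
    fix x
    show "(\<Sum>y\<in>UNIV. \<alpha> x * \<theta> x * (\<beta> y * \<theta> y)) = (\<Sum>s\<in>UNIV. \<alpha> x * \<beta> (s - x) * \<theta> s)"
      by (rule sum.reindex_bij_witness[of _ "\<lambda>s. s - x" "\<lambda>y. y + x"])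
         (auto simp: add_char_add mult_ac)
  qed
  also have "\<dots> = (\<Sum>s\<in>UNIV. f s * \<theta> s)"
    by (subst sum.swap) (simp add: f_def sum_distrib_right)
  also have "\<dots> = f 1 * g (\<alpha> * \<beta>)"
    by (rule sum_homogeneous_add_char) (use assms hom in auto)
  finally show ?thesis by (simp add: f_def mult_ac)
qed

lemma gauss_sum_mult_jacobi3:
  assumes abc: "a \<in> mult_chars" "b \<in> mult_chars" "c \<in> mult_chars" "a * b * c \<noteq> triv_char"
  shows "g a * g b * g c = g (a * b * c) * (\<Sum>u\<in>UNIV. \<Sum>v\<in>UNIV. a u * b v * c (1 - u - v))"
proof -
  define f where "f s = (\<Sum>u\<in>UNIV. \<Sum>v\<in>UNIV. a u * b v * c (s - u - v))" for s
  have hom: "f (t * s) = (a * b * c) t * f s" if "t \<noteq> 0" for t s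
  proof -
    have "f (t * s) = (\<Sum>u\<in>UNIV. \<Sum>v\<in>UNIV. a (t * u) * b v * c (t * s - t * u - v))" unfolding f_def
      by (rule sum.reindex_bij_witness[of _ "\<lambda>x. t * x" "\<lambda>x. x / t"]) (use that in auto)
    also have "\<dots> = (\<Sum>u\<in>UNIV. \<Sum>v\<in>UNIV. a (t * u) * b (t * v) * c (t * s - t * u - t * v))"
    proof (rule sum.cong[OF refl])
      fix u
      show "(\<Sum>v\<in>UNIV. a (t * u) * b v * c (t * s - t * u - v)) =
            (\<Sum>v\<in>UNIV. a (t * u) * b (t * v) * c (t * s - t * u - t * v))"
        by (rule sum.reindex_bij_witness[of _ "\<lambda>x. t * x" "\<lambda>x. x / t"]) (use that in auto)
    qed
    finally show ?thesis
      using abc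
      by (simp add: f_def sum_distrib_left mult_chars_mult flip: right_diff_distrib) (simp add: mult_ac)
  qed
  have "g a * g b * g c = g a * (g b * g c)" by (simp add: mult_ac)
  also have "\<dots> = (\<Sum>u\<in>UNIV. \<Sum>v\<in>UNIV. \<Sum>w\<in>UNIV. a u * \<theta> u * (b v * \<theta> v * (c w * \<theta> w)))"
    unfolding gauss_sum_def sum_product by (simp add: sum_distrib_left sum_distrib_right)
  also have "\<dots> = (\<Sum>u\<in>UNIV. \<Sum>v\<in>UNIV. \<Sum>s\<in>UNIV. a u * b v * c (s - u - v) * \<theta> s)"
  proof (rule sum.cong[OF refl], rule sum.cong[OF refl])
    fix u v
    show "(\<Sum>w\<in>UNIV. a u * \<theta> u * (b v * \<theta> v * (c w * \<theta> w))) =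
        (\<Sum>s\<in>UNIV. a u * b v * c (s - u - v) * \<theta> s)"
      by (rule sum.reindex_bij_witness[of _ "\<lambda>s. s - u - v" "\<lambda>w. w + u + v"])
         (auto simp: add_char_add mult_ac)
  qed
  also have "\<dots> = (\<Sum>u\<in>UNIV. \<Sum>s\<in>UNIV. \<Sum>v\<in>UNIV. a u * b v * c (s - u - v) * \<theta> s)"
    by (rule sum.cong[OF refl], rule sum.swap)
  also have "\<dots> = (\<Sum>s\<in>UNIV. f s * \<theta> s)"
    by (subst sum.swap) (simp add: f_def sum_distrib_right)
  also have "\<dots> = f 1 * g (a * b * c)"
    by (rule sum_homogeneous_add_char) (use abc hom in auto)
  finally show ?thesis by (simp add: f_def mult_ac)
qed

end

subsection \<open>A surface as a double cover of the plane\<close>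

text \<open>With \<open>p = x * y * z\<close> there is the identity
  \<open>y * (1 - u) = v + p\<close>, linear in \<open>y\<close>. It determines \<open>y\<close>,
  then \<open>v\<close> determines \<open>x\<close> and \<open>u\<close> determines
  \<open>z\<close>.\<close>

lemma surface_point_unique:
  fixes x y z x' y' z' u v :: "'a :: field"
  assumes "u \<noteq> 1" "v \<noteq> 0" "u \<noteq> 0"
    and "x * (1 - z) = u" "y * (1 - x) = v" "x' * (1 - z') = u" "y' * (1 - x') = v"
    and "x * y * z = x' * y' * z'"
  shows "x = x' \<and> y = y' \<and> z = z'"
proof -
  have *: "r * (1 - s * (1 - t)) = r * (1 - s) + s * r * t" for r s t :: 'a
    by (simp add: algebra_simps)
  have "y * (1 - u) = v + x * y * z" "y' * (1 - u) = v + x' * y' * z'"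
    using *[of y x z] *[of y' x' z'] assms(4-7) by simp_all
  then have "y * (1 - u) = y' * (1 - u)" using assms(8) by simp
  then have y: "y = y'" using assms(1) by simp
  have "y \<noteq> 0" using assms(2,5) by auto
  then have "1 - x = 1 - x'" using assms(5,7) y by (metis mult_left_cancel)
  then have x: "x = x'" by simp
  have "x \<noteq> 0" using assms(3,4) by auto
  then have "1 - z = 1 - z'" using assms(4,6) x by (metis mult_left_cancel)
  then show ?thesis using x y by simp
qed

text \<open>The coordinates are solved for as in the uniqueness proof: \<open>y\<close> from
  \<open>y * (1 - u) = v + p\<close>, then \<open>x\<close> from \<open>v\<close>, then
  \<open>z\<close> from \<open>p\<close>. The divisions are legitimate off the excluded lines:
  \<open>v + p = 0\<close> would force \<open>w = 1\<close> and \<open>p = u\<close>, while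
  \<open>p + u * v = 0\<close> would force \<open>v = 1\<close> and \<open>p = w\<close>.\<close>

lemma surface_point_exists:
  fixes u v w p :: "'a :: field"
  assumes nz: "u \<noteq> 0" "v \<noteq> 0" "w \<noteq> 0" and sum: "u + v + w = 1" and p: "p ^ 2 = - (u * v * w)"
    and u: "u \<noteq> 1" and good: "\<not> (v = 1 \<and> p = w)" "\<not> (w = 1 \<and> p = u)"
  shows "\<exists>x y z. x * (1 - z) = u \<and> y * (1 - x) = v \<and> z * (1 - y) = w \<and> x * y * z = p"
proof -
  have u1: "1 - u \<noteq> 0" using u by simp
  have vp: "v + p \<noteq> 0"
  proof
    assume "v + p = 0"
    then have pv: "p = - v" by Groebner_Basis.algebra
    have "v * (v + u * w) = 0" using p pv by Groebner_Basis.algebra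
    then have "v + u * w = 0" using nz by simp
    then have "(1 - w) * (u - 1) = 0" using sum by Groebner_Basis.algebra
    then have "w = 1" using u by simp
    then show False using good(2) pv sum by (metis add.commute add_cancel_right_left eq_neg_iff_add_eq_0)
  qed
  have puv: "p + u * v \<noteq> 0"
  proof
    assume "p + u * v = 0"
    then have pv: "p = - (u * v)" by Groebner_Basis.algebra
    have "u * v * (u * v + w) = 0" using p pv by Groebner_Basis.algebra
    then have "u * v + w = 0" using nz by simp
    then have "(1 - u) * (1 - v) = 0" using sum by Groebner_Basis.algebra
    then have v: "v = 1" using u by simp
    then have "w = - u" using sum by Groebner_Basis.algebra
    then show False using good(1) pv v by simp
  qed
  define y where "y = (v + p) / (1 - u)"
  define x where "x = 1 - v / y"
  define z where "z = p / (x * y)"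
  have y: "y \<noteq> 0" using vp u1 by (simp add: y_def)
  have yu: "y * (1 - u) = v + p" using u1 by (simp add: y_def)
  have xy: "x * y = y - v" using y by (simp add: x_def field_simps)
  have "x * y * (1 - u) = p + u * v" using xy yu by Groebner_Basis.algebra
  then have xy0: "x * y \<noteq> 0" using puv by auto
  then have xyz: "x * y * z = p" by (simp add: z_def)
  have 2: "y * (1 - x) = v" using xy by Groebner_Basis.algebra
  have "y * (x * (1 - z)) = y * u" using xy xyz yu by Groebner_Basis.algebra
  then have 1: "x * (1 - z) = u" using y by simp
  \<comment> \<open>Cleared of denominators, both sides are \<open>w * (p + u * v)\<close>; on the
    left this uses \<open>p ^ 2 = - (u * v * w)\<close>.\<close>
  have "(1 - u) * (x * y * (z * (1 - y))) = (1 - u) * (x * y * w)"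
    using xy xyz yu p sum by Groebner_Basis.algebra
  then have "z * (1 - y) = w" using u1 xy0 by simp
  then show ?thesis using 1 2 xyz by (intro exI[of _ x] exI[of _ y] exI[of _ z]) simp
qed

text \<open>The points at which orthogonality in \<chi> leaves a contribution from the product of
  three Jacobi sums.\<close>

definition jacobi_surface :: "('a :: field \<times> 'a \<times> 'a) set" where
  "jacobi_surface = {(x, y, z). x \<noteq> 0 \<and> y \<noteq> 0 \<and> z \<noteq> 0 \<and> x \<noteq> 1 \<and> y \<noteq> 1 \<and> z \<noteq> 1 \<and>
     x * y * z = - ((1 - x) * (1 - y) * (1 - z))}"

definition double_plane :: "('a :: field \<times> 'a \<times> 'a) set" where
  "double_plane = {(u, v, p). u \<noteq> 0 \<and> v \<noteq> 0 \<and> 1 - u - v \<noteq> 0 \<and> p ^ 2 = - (u * v * (1 - u - v))}"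

text \<open>With \<open>w = 1 - u - v\<close> the lines are \<open>u = 1, p = v\<close>, then
  \<open>v = 1, p = w\<close>, then \<open>w = 1, p = u\<close>: one line and its cyclic
  images.\<close>

definition missed_lines :: "('a :: field \<times> 'a \<times> 'a) set" where
  "missed_lines = (\<lambda>t. (1, t, t)) ` (- {0}) \<union> (\<lambda>t. (t, 1, - t)) ` (- {0}) \<union> (\<lambda>t. (t, - t, t)) ` (- {0})"

definition surface_map :: "'a :: field \<times> 'a \<times> 'a \<Rightarrow> 'a \<times> 'a \<times> 'a" where
  "surface_map = (\<lambda>(x, y, z). (x * (1 - z), y * (1 - x), x * y * z))"

lemma minus_one_neq_one:
  assumes "(2 :: 'a :: field) \<noteq> 0"
  shows "(-1 :: 'a) \<noteq> 1"
  using assms by (metis add.right_inverse one_add_one)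

text \<open>Identically, \<open>x * (1 - z) + y * (1 - x) + z * (1 - y)\<close> equals
  \<open>1 - x * y * z - (1 - x) * (1 - y) * (1 - z)\<close>, so the surface equation says that the
  three products add up to 1.\<close>

lemma jacobi_surface_third_coordinate:
  assumes "(x, y, z) \<in> jacobi_surface"
  shows "1 - x * (1 - z) - y * (1 - x) = z * (1 - y)"
proof -
  have "x * y * z = - ((1 - x) * (1 - y) * (1 - z))"
    using assms by (simp add: jacobi_surface_def)
  then show ?thesis by Groebner_Basis.algebra
qed

lemma surface_map_in_double_plane:
  fixes x y z :: "'a :: field"
  assumes two: "(2 :: 'a) \<noteq> 0" and P: "(x, y, z) \<in> jacobi_surface"
  shows "surface_map (x, y, z) \<in> double_plane - missed_lines"
proof -
  define u v w p where "u = x * (1 - z)" and "v = y * (1 - x)" and "w = z * (1 - y)" and "p = x * y * z"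
  have w: "1 - u - v = w"
    using jacobi_surface_third_coordinate[OF P] by (simp add: u_def v_def w_def)
  have nz: "u \<noteq> 0" "v \<noteq> 0" "w \<noteq> 0"
    using P by (auto simp: jacobi_surface_def u_def v_def w_def)
  have "x * y * z = - ((1 - x) * (1 - y) * (1 - z))"
    using P by (simp add: jacobi_surface_def)
  then have p: "p ^ 2 = - (u * v * w)"
    unfolding u_def v_def w_def p_def by Groebner_Basis.algebra
  \<comment> \<open>On a missed line one of these equations has left side 0 and right side
    \<open>2 * t\<close> or \<open>- 2 * t\<close>, which is impossible for nonzero
    \<open>t\<close>.\<close>
  have lin: "y * (1 - u) = v + p" "z * (1 - v) = w + p" "x * (1 - w) = u + p"
    by (simp_all add: u_def v_def w_def p_def algebra_simps)
  have "(u, v, p) \<noteq> (1, t, t)" if "t \<noteq> 0" for t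
  proof
    assume "(u, v, p) = (1, t, t)"
    then have "t + t = 0" using lin(1) by simp
    then show False using two that by (metis mult_2 mult_eq_0_iff)
  qed
  moreover have "(u, v, p) \<noteq> (t, 1, - t)" if "t \<noteq> 0" for t
  proof
    assume *: "(u, v, p) = (t, 1, - t)"
    then have "w = - t" using w by auto
    then have "- t + - t = 0" using lin(2) * by simp
    then have "t + t = 0" by Groebner_Basis.algebra
    then show False using two that by (metis mult_2 mult_eq_0_iff)
  qed
  moreover have "(u, v, p) \<noteq> (t, - t, t)" if "t \<noteq> 0" for t
  proof
    assume *: "(u, v, p) = (t, - t, t)"
    then have "w = 1" using w by auto
    then have "t + t = 0" using lin(3) * by simp
    then show False using two that by (metis mult_2 mult_eq_0_iff)
  qed
  ultimately have "(u, v, p) \<notin> missed_lines"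
    unfolding missed_lines_def by blast
  moreover have "(u, v, p) \<in> double_plane"
    using nz p by (simp only: double_plane_def w mem_Collect_eq prod.case) simp
  ultimately show ?thesis by (simp add: surface_map_def u_def v_def p_def)
qed

lemma inj_on_surface_map:
  assumes two: "(2 :: 'a :: field) \<noteq> 0"
  shows "inj_on surface_map (jacobi_surface :: ('a \<times> 'a \<times> 'a) set)"
proof (rule inj_onI)
  fix P P' :: "'a \<times> 'a \<times> 'a"
  assume mem: "P \<in> jacobi_surface" "P' \<in> jacobi_surface" and eq: "surface_map P = surface_map P'"
  obtain x y z x' y' z' where P: "P = (x, y, z)" "P' = (x', y', z')"
    by (cases P, cases P') auto
  define u v w where "u = x * (1 - z)" and "v = y * (1 - x)" and "w = z * (1 - y)"
  have u: "x * (1 - z) = u" "x' * (1 - z') = u" and v: "y * (1 - x) = v" "y' * (1 - x') = v"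
    and p: "x * y * z = x' * y' * z'"
    using eq by (simp_all add: P surface_map_def u_def v_def)
  have w: "z * (1 - y) = w" "z' * (1 - y') = w" and sum: "1 - u - v = w"
    using jacobi_surface_third_coordinate[OF mem(1)[unfolded P]]
      jacobi_surface_third_coordinate[OF mem(2)[unfolded P]] u v by (simp_all add: w_def)
  have nz: "u \<noteq> 0" "v \<noteq> 0" "w \<noteq> 0"
    using mem(1) by (auto simp: P jacobi_surface_def u_def v_def w_def)
  \<comment> \<open>In the last case \<open>w = -1\<close> differs from 1, so after a cyclic
    relabelling the uniqueness lemma always applies.\<close>
  consider "u \<noteq> 1" | "v \<noteq> 1" | "u = 1" "v = 1" by blast
  then have "x = x' \<and> y = y' \<and> z = z'"
  proof cases
    case 1
    then show ?thesis using surface_point_unique[OF 1 nz(2,1) u(1) v(1) u(2) v(2) p] by simp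
  next
    case 2
    have "y * z * x = y' * z' * x'" using p by (simp add: mult_ac)
    from surface_point_unique[OF 2 nz(3,2) v(1) w(1) v(2) w(2) this] show ?thesis by simp
  next
    case 3
    have "w \<noteq> 1" using sum 3 minus_one_neq_one[OF two] by simp
    have "z * x * y = z' * x' * y'" using p by (simp add: mult_ac)
    from surface_point_unique[OF \<open>w \<noteq> 1\<close> nz(1,3) w(1) u(1) w(2) u(2) this] show ?thesis by simp
  qed
  then show "P = P'" by (simp add: P)
qed

lemma double_plane_in_surface_map_image:
  fixes u v p :: "'a :: field"
  assumes two: "(2 :: 'a) \<noteq> 0" and Q: "(u, v, p) \<in> double_plane - missed_lines"
  shows "(u, v, p) \<in> surface_map ` jacobi_surface"
proof -
  define w where "w = 1 - u - v"
  have nz: "u \<noteq> 0" "v \<noteq> 0" "w \<noteq> 0" and p: "p ^ 2 = - (u * v * w)"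
    using Q by (auto simp: double_plane_def w_def)
  have sum: "u + v + w = 1" by (simp add: w_def)
  have missed: "(u, v, p) \<noteq> (1, t, t)" "(u, v, p) \<noteq> (t, 1, - t)" "(u, v, p) \<noteq> (t, - t, t)"
    if "t \<noteq> 0" for t
    using Q that unfolding missed_lines_def by blast+
  have good1: "\<not> (u = 1 \<and> p = v)"
    using missed(1)[OF nz(2)] by simp
  have good2: "\<not> (v = 1 \<and> p = w)"
    using missed(2)[OF nz(1)] by (auto simp: w_def)
  have good3: "\<not> (w = 1 \<and> p = u)"
  proof
    assume *: "w = 1 \<and> p = u"
    then have "v = - u" using sum by (simp add: eq_neg_iff_add_eq_0 add.commute)
    then show False using missed(3)[OF nz(1)] * by simp
  qed
  have "\<exists>x y z. x * (1 - z) = u \<and> y * (1 - x) = v \<and> z * (1 - y) = w \<and> x * y * z = p"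
  proof -
    consider "u \<noteq> 1" | "v \<noteq> 1" | "u = 1" "v = 1" by blast
    then show ?thesis
    proof cases
      case 1
      from surface_point_exists[OF nz sum p 1 good2 good3] show ?thesis .
    next
      case 2
      have "v + w + u = 1" "p ^ 2 = - (v * w * u)" using sum p by (simp_all add: ac_simps)
      from surface_point_exists[OF nz(2,3,1) this 2 good3 good1]
      obtain x y z where "y * (1 - x) = v" "z * (1 - y) = w" "x * (1 - z) = u" "y * z * x = p"
        by auto
      then show ?thesis
        by (intro exI[of _ x] exI[of _ y] exI[of _ z]) (simp add: mult_ac)
    next
      case 3
      have "w \<noteq> 1" using 3 minus_one_neq_one[OF two] by (simp add: w_def)
      have "w + u + v = 1" "p ^ 2 = - (w * u * v)" using sum p by (simp_all add: ac_simps)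
      from surface_point_exists[OF nz(3,1,2) this \<open>w \<noteq> 1\<close> good1 good2]
      obtain x y z where "z * (1 - y) = w" "x * (1 - z) = u" "y * (1 - x) = v" "z * x * y = p"
        by auto
      then show ?thesis
        by (intro exI[of _ x] exI[of _ y] exI[of _ z]) (simp add: mult_ac)
    qed
  qed
  then obtain x y z where xyz: "x * (1 - z) = u" "y * (1 - x) = v" "z * (1 - y) = w" "x * y * z = p"
    by auto
  \<comment> \<open>The identity behind \<open>jacobi_surface_third_coordinate\<close>, now read
    from \<open>u + v + w = 1\<close> to the surface equation.\<close>
  have "x * y * z = - ((1 - x) * (1 - y) * (1 - z))"
    using sum unfolding xyz(1-3)[symmetric] by Groebner_Basis.algebra
  then have "(x, y, z) \<in> jacobi_surface"
    using nz xyz(1-3) by (auto simp: jacobi_surface_def)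
  then show ?thesis
    by (rule rev_image_eqI) (simp add: surface_map_def xyz)
qed

lemma bij_betw_surface_map:
  assumes two: "(2 :: 'a :: field) \<noteq> 0"
  shows "bij_betw surface_map (jacobi_surface :: ('a \<times> 'a \<times> 'a) set) (double_plane - missed_lines)"
  unfolding bij_betw_def
proof (intro conjI inj_on_surface_map[OF two] equalityI subsetI)
  fix s :: "'a \<times> 'a \<times> 'a"
  assume "s \<in> surface_map ` jacobi_surface"
  then show "s \<in> double_plane - missed_lines"
    using surface_map_in_double_plane[OF two] by auto
next
  fix s :: "'a \<times> 'a \<times> 'a"
  assume "s \<in> double_plane - missed_lines"
  then show "s \<in> surface_map ` jacobi_surface"
    using double_plane_in_surface_map_image[OF two] by (cases s) auto
qed

section \<open>Character sums over the surface and the missed lines\<close>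

lemma sum_UNIV_triple:
  "(\<Sum>s\<in>S. f s) = (\<Sum>x\<in>UNIV. \<Sum>y\<in>UNIV. \<Sum>z\<in>UNIV. if (x, y, z) \<in> S then f (x, y, z) else 0)"
  for S :: "('b :: finite \<times> 'c :: finite \<times> 'd :: finite) set" and f :: "_ \<Rightarrow> 'e :: comm_monoid_add"
proof -
  have "(\<Sum>s\<in>S. f s) = (\<Sum>s\<in>UNIV \<times> UNIV \<times> UNIV. if s \<in> S then f s else 0)"
    by (simp add: sum.If_cases)
  then show ?thesis by (simp only: sum.cartesian_product' split_def fst_conv snd_conv)
qed

lemma sum_mult_char_antidiagonal:
  assumes "\<alpha> \<in> mult_chars" "\<beta> \<in> mult_chars" "\<alpha> * \<beta> \<noteq> triv_char"
  shows "(\<Sum>t\<in>- {0}. \<alpha> t * \<beta> (- t)) = 0"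
proof -
  have *: "\<alpha> t * \<beta> (- t) = \<beta> (-1) * (\<alpha> * \<beta>) t" for t
    using mult_chars_minus[OF assms(2), of t] by simp
  have "(\<Sum>t\<in>- {0}. \<alpha> t * \<beta> (- t)) = (\<Sum>t\<in>UNIV. \<beta> (-1) * (\<alpha> * \<beta>) t)"
    unfolding * by (rule sum.mono_neutral_left) (use assms in \<open>auto simp: mult_chars_zero\<close>)
  also have "\<dots> = \<beta> (-1) * (\<Sum>t\<in>UNIV. (\<alpha> * \<beta>) t)"
    by (rule sum_distrib_left[symmetric])
  also have "(\<Sum>t\<in>UNIV. (\<alpha> * \<beta>) t) = 0"
    by (rule sum_mult_char[OF mult_chars_times_closed[OF assms(1,2)] assms(3)])
  finally show ?thesis by simp
qed

text \<open>On each line one of the three characters is evaluated at 1 and the other two at opposite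
  arguments, so the sum is that of a nontrivial product of two characters.\<close>

lemma sum_missed_lines:
  fixes a b c :: "'a :: {field, finite} \<Rightarrow> complex"
  assumes two: "(2 :: 'a) \<noteq> 0" and abc: "a \<in> mult_chars" "b \<in> mult_chars" "c \<in> mult_chars"
    and nt: "a * b \<noteq> triv_char" "b * c \<noteq> triv_char" "a * c \<noteq> triv_char"
  shows "(\<Sum>(u, v, p)\<in>missed_lines. a u * b v * c (1 - u - v)) = 0"
proof -
  let ?f = "\<lambda>(u, v, p :: 'a). a u * b v * c (1 - u - v)"
  let ?L1 = "(\<lambda>t :: 'a. (1, t, t)) ` (- {0})" and ?L2 = "(\<lambda>t :: 'a. (t, 1, - t)) ` (- {0})"
    and ?L3 = "(\<lambda>t :: 'a. (t, - t, t)) ` (- {0})"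
  note m = minus_one_neq_one[OF two]
  have "(\<Sum>s\<in>?L1. ?f s) = (\<Sum>t\<in>- {0}. b t * c (- t))"
    by (subst sum.reindex) (auto simp: inj_on_def mult_chars_one[OF abc(1)])
  then have 1: "(\<Sum>s\<in>?L1. ?f s) = 0"
    using sum_mult_char_antidiagonal abc nt by simp
  have "(\<Sum>s\<in>?L2. ?f s) = (\<Sum>t\<in>- {0}. a t * c (- t))"
    by (subst sum.reindex) (auto simp: inj_on_def mult_chars_one[OF abc(2)])
  then have 2: "(\<Sum>s\<in>?L2. ?f s) = 0"
    using sum_mult_char_antidiagonal abc nt by simp
  have "(\<Sum>s\<in>?L3. ?f s) = (\<Sum>t\<in>- {0}. a t * b (- t))"
    by (subst sum.reindex) (auto simp: inj_on_def mult_chars_one[OF abc(3)])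
  then have 3: "(\<Sum>s\<in>?L3. ?f s) = 0"
    using sum_mult_char_antidiagonal abc nt by simp
  \<comment> \<open>A common point of two lines would give \<open>1 = -1\<close>.\<close>
  have disj: "?L1 \<inter> ?L2 = {}" "(?L1 \<union> ?L2) \<inter> ?L3 = {}"
    using m by auto
  show ?thesis
    unfolding missed_lines_def
    by (simp only: sum.union_disjoint[OF finite finite disj(2)] sum.union_disjoint[OF finite finite disj(1)] 1 2 3) simp
qed

text \<open>The fibre over \<open>(u, v)\<close> has \<open>1 + \<phi> t\<close> points, where
  \<open>t = - (u * v * (1 - u - v))\<close>, and \<phi> spreads over the factors of
  \<open>t\<close>. Where \<open>t = 0\<close> the fibre is empty, and both terms on the right
  vanish because characters are 0 at 0.\<close>

lemma sum_double_plane: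
  fixes a b c :: "'a :: {field, finite} \<Rightarrow> complex"
  assumes odd: "odd CARD('a)" and abc: "a \<in> mult_chars" "b \<in> mult_chars" "c \<in> mult_chars"
  defines "\<phi> \<equiv> quad_char"
  shows "(\<Sum>(u, v, p)\<in>double_plane. a u * b v * c (1 - u - v)) =
    (\<Sum>u\<in>UNIV. \<Sum>v\<in>UNIV. a u * b v * c (1 - u - v)) +
    \<phi> (-1) * (\<Sum>u\<in>UNIV. \<Sum>v\<in>UNIV. (a * \<phi>) u * (b * \<phi>) v * (c * \<phi>) (1 - u - v))"
proof -
  have \<phi>: "\<phi> \<in> mult_chars" using quad_char_closed[OF odd] by (simp add: \<phi>_def)
  have fib: "(\<Sum>p\<in>UNIV. if (u, v, p) \<in> double_plane then a u * b v * c (1 - u - v) else 0) =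
      a u * b v * c (1 - u - v) + \<phi> (-1) * ((a * \<phi>) u * (b * \<phi>) v * (c * \<phi>) (1 - u - v))" for u v
  proof (cases "u = 0 \<or> v = 0 \<or> 1 - u - v = 0")
    case True
    then have "a u * b v * c (1 - u - v) = 0" using abc by (auto simp: mult_chars_zero)
    then show ?thesis using True \<phi> by (auto simp: mult_chars_zero double_plane_def)
  next
    case False
    define t where "t = - (u * v * (1 - u - v))"
    have t: "t \<noteq> 0" using False by (simp add: t_def)
    have "(\<Sum>p\<in>UNIV. if (u, v, p) \<in> double_plane then a u * b v * c (1 - u - v) else 0) =
        (\<Sum>p\<in>{p. p ^ 2 = t}. a u * b v * c (1 - u - v))"
      by (rule sum.mono_neutral_cong_right) (use False in \<open>auto simp: double_plane_def t_def\<close>)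
    also have "\<dots> = (1 + \<phi> t) * (a u * b v * c (1 - u - v))"
      using card_square_roots[OF odd t] by (simp add: \<phi>_def)
    also have "\<phi> t = \<phi> (-1) * (\<phi> u * \<phi> v * \<phi> (1 - u - v))"
      unfolding t_def by (simp add: mult_chars_minus[OF \<phi>, of "u * v * (1 - u - v)"] mult_chars_mult[OF \<phi>])
    finally show ?thesis by (simp add: algebra_simps)
  qed
  have "(\<Sum>(u, v, p)\<in>double_plane. a u * b v * c (1 - u - v)) =
     (\<Sum>u\<in>UNIV. \<Sum>v\<in>UNIV. \<Sum>p\<in>UNIV. if (u, v, p) \<in> double_plane then a u * b v * c (1 - u - v) else 0)"
    by (subst sum_UNIV_triple) (simp only: prod.case)
  then show ?thesis
    by (simp only: fib sum.distrib sum_distrib_left)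
qed

lemma sum_jacobi_surface:
  fixes a b c :: "'a :: {field, finite} \<Rightarrow> complex"
  assumes odd: "odd CARD('a)" and abc: "a \<in> mult_chars" "b \<in> mult_chars" "c \<in> mult_chars"
    and nt: "a * b \<noteq> triv_char" "b * c \<noteq> triv_char" "a * c \<noteq> triv_char"
  defines "\<phi> \<equiv> quad_char"
  shows "(\<Sum>(x, y, z)\<in>jacobi_surface. a (x * (1 - z)) * b (y * (1 - x)) * c (z * (1 - y))) =
    (\<Sum>u\<in>UNIV. \<Sum>v\<in>UNIV. a u * b v * c (1 - u - v)) +
    \<phi> (-1) * (\<Sum>u\<in>UNIV. \<Sum>v\<in>UNIV. (a * \<phi>) u * (b * \<phi>) v * (c * \<phi>) (1 - u - v))"
proof -
  note two = two_neq_zero[OF odd]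
  let ?f = "\<lambda>(u, v, p :: 'a). a u * b v * c (1 - u - v)"
  have "(\<Sum>(x, y, z)\<in>jacobi_surface. a (x * (1 - z)) * b (y * (1 - x)) * c (z * (1 - y))) =
      (\<Sum>s\<in>jacobi_surface. ?f (surface_map s))"
    by (rule sum.cong) (auto simp: surface_map_def jacobi_surface_third_coordinate)
  also have "\<dots> = (\<Sum>s\<in>double_plane - missed_lines. ?f s)"
    by (rule sum.reindex_bij_betw[OF bij_betw_surface_map[OF two]])
  also have "\<dots> = (\<Sum>s\<in>double_plane. ?f s) - (\<Sum>s\<in>missed_lines. ?f s)"
    by (rule sum_diff) (auto simp: missed_lines_def double_plane_def power2_eq_square)
  also have "(\<Sum>s\<in>missed_lines. ?f s) = 0"
    by (rule sum_missed_lines[OF two abc nt])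
  finally show ?thesis
    using sum_double_plane[OF odd abc] by (simp add: \<phi>_def)
qed

subsection \<open>The well-poised sum\<close>

context nontrivial_add_char
begin

definition wp_sum :: "('a \<Rightarrow> complex) \<Rightarrow> ('a \<Rightarrow> complex) \<Rightarrow> ('a \<Rightarrow> complex) \<Rightarrow> complex" where
  "wp_sum a b c = (\<Sum>\<chi>\<in>mult_chars. \<chi> (-1) * (g (a * \<chi>) * g (a * inverse \<chi>)) *
     (g (b * \<chi>) * g (b * inverse \<chi>)) * (g (c * \<chi>) * g (c * inverse \<chi>)))"

definition wp_value :: "('a \<Rightarrow> complex) \<Rightarrow> ('a \<Rightarrow> complex) \<Rightarrow> ('a \<Rightarrow> complex) \<Rightarrow> complex" where
  "wp_value a b c = (of_nat CARD('a) - 1) * (g (a * b) * g (b * c) * g (a * c)) *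
     (g a * g b * g c / g (a * b * c) +
      quad_char (-1 :: 'a) * (g (a * quad_char) * g (b * quad_char) * g (c * quad_char)) /
        g (a * b * c * quad_char))"

text \<open>The symmetry reduces a trivial pairwise product to the case that \<open>a * b\<close> is
  trivial.\<close>

lemma wp_sum_commute: "wp_sum a b c = wp_sum b a c" "wp_sum a b c = wp_sum a c b"
  unfolding wp_sum_def by (simp_all add: mult_ac)

lemma wp_value_commute: "wp_value a b c = wp_value b a c" "wp_value a b c = wp_value a c b"
  unfolding wp_value_def by (simp_all add: mult_ac)

lemma wp_sum_generic:
  assumes odd: "odd CARD('a)" and abc: "a \<in> mult_chars" "b \<in> mult_chars" "c \<in> mult_chars"
    and nt: "a * b \<noteq> triv_char" "b * c \<noteq> triv_char" "a * c \<noteq> triv_char"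
    and ntt: "a * b * c \<noteq> triv_char" "a * b * c * quad_char \<noteq> triv_char"
  shows "wp_sum a b c = wp_value a b c"
proof -
  define \<phi> :: "'a \<Rightarrow> complex" where "\<phi> = quad_char"
  have \<phi>: "\<phi> \<in> mult_chars" "\<phi> * \<phi> = triv_char"
    using quad_char_closed[OF odd] quad_char_square[OF odd] by (simp_all add: \<phi>_def)
  define F where "F = (\<lambda>(x, y, z). a (x * (1 - z)) * b (y * (1 - x)) * c (z * (1 - y)))"
  \<comment> \<open>The total argument of \<chi>: each Jacobi sum contributes a factor
    \<open>x / (1 - x)\<close>, and \<open>\<chi> (-1)\<close> the sign. Since division by 0 gives
    0, a point with a coordinate 0 or 1 has \<open>r s = 0\<close> and drops out.\<close>
  define r :: "'a \<times> 'a \<times> 'a \<Rightarrow> 'a"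
    where "r = (\<lambda>(x, y, z). - (x * y * z) / ((1 - x) * (1 - y) * (1 - z)))"
  have r: "r s = 1 \<longleftrightarrow> s \<in> jacobi_surface" for s
  proof (cases s)
    case (fields x y z)
    have "r s = 1 \<longleftrightarrow> (1 - x) * (1 - y) * (1 - z) \<noteq> 0 \<and> - (x * y * z) = (1 - x) * (1 - y) * (1 - z)"
      unfolding fields r_def prod.case by (rule divide_eq_1_iff)
    also have "- (x * y * z) = (1 - x) * (1 - y) * (1 - z) \<longleftrightarrow> x * y * z = - ((1 - x) * (1 - y) * (1 - z))"
      by (metis minus_minus)
    finally show ?thesis by (auto simp: fields jacobi_surface_def)
  qed
  have jac: "g (\<alpha> * \<chi>) * g (\<beta> * inverse \<chi>) =
      g (\<alpha> * \<beta>) * (\<Sum>x\<in>UNIV. \<alpha> x * \<beta> (1 - x) * (\<chi> x / \<chi> (1 - x)))"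
    if "\<alpha> \<in> mult_chars" "\<beta> \<in> mult_chars" "\<chi> \<in> mult_chars" "\<alpha> * \<beta> \<noteq> triv_char" for \<alpha> \<beta> \<chi>
  proof -
    have "(\<alpha> * \<chi>) * (\<beta> * inverse \<chi>) = (\<chi> * inverse \<chi>) * (\<alpha> * \<beta>)"
      by (simp add: mult_ac)
    also have "\<dots> = \<alpha> * \<beta>"
      using that by (simp add: mult_chars_right_inverse triv_char_mult mult_chars_times_closed)
    finally have *: "(\<alpha> * \<chi>) * (\<beta> * inverse \<chi>) = \<alpha> * \<beta>" .
    have "g (\<alpha> * \<chi>) * g (\<beta> * inverse \<chi>) =
        g (\<alpha> * \<beta>) * (\<Sum>x\<in>UNIV. (\<alpha> * \<chi>) x * (\<beta> * inverse \<chi>) (1 - x))"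
      using gauss_sum_mult_jacobi[of "\<alpha> * \<chi>" "\<beta> * inverse \<chi>"] that unfolding * by blast
    then show ?thesis by (simp add: divide_inverse mult_ac)
  qed
  have summand: "\<chi> (-1) * (g (a * \<chi>) * g (a * inverse \<chi>)) * (g (b * \<chi>) * g (b * inverse \<chi>)) *
      (g (c * \<chi>) * g (c * inverse \<chi>)) =
      g (a * b) * g (b * c) * g (a * c) * (\<Sum>s\<in>UNIV. F s * \<chi> (r s))" if \<chi>: "\<chi> \<in> mult_chars" for \<chi>
  proof -
    define J where "J \<alpha> \<beta> x = \<alpha> x * \<beta> (1 - x) * (\<chi> x / \<chi> (1 - x))" for \<alpha> \<beta> :: "'a \<Rightarrow> complex" and x
    have "\<chi> (-1) * (g (a * \<chi>) * g (a * inverse \<chi>)) * (g (b * \<chi>) * g (b * inverse \<chi>)) *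
        (g (c * \<chi>) * g (c * inverse \<chi>)) = \<chi> (-1) * (g (a * \<chi>) * g (b * inverse \<chi>)) *
        ((g (b * \<chi>) * g (c * inverse \<chi>)) * (g (c * \<chi>) * g (a * inverse \<chi>)))"
      by (simp add: mult_ac)
    also have "\<dots> = g (a * b) * g (b * c) * g (a * c) *
        (\<chi> (-1) * ((\<Sum>x\<in>UNIV. J a b x) * ((\<Sum>y\<in>UNIV. J b c y) * (\<Sum>z\<in>UNIV. J c a z))))"
    proof -
      have ca: "c * a = a * c" by (rule mult.commute)
      have "g (a * \<chi>) * g (b * inverse \<chi>) = g (a * b) * (\<Sum>x\<in>UNIV. J a b x)"
        "g (b * \<chi>) * g (c * inverse \<chi>) = g (b * c) * (\<Sum>x\<in>UNIV. J b c x)"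
        "g (c * \<chi>) * g (a * inverse \<chi>) = g (a * c) * (\<Sum>x\<in>UNIV. J c a x)"
        unfolding J_def using jac[of a b \<chi>] jac[of b c \<chi>] jac[of c a \<chi>] abc \<chi> nt ca by simp_all
      then show ?thesis by (simp only:) (simp only: mult_ac)
    qed
    also have "\<chi> (-1) * ((\<Sum>x\<in>UNIV. J a b x) * ((\<Sum>y\<in>UNIV. J b c y) * (\<Sum>z\<in>UNIV. J c a z))) =
        (\<Sum>x\<in>UNIV. \<Sum>y\<in>UNIV. \<Sum>z\<in>UNIV. \<chi> (-1) * (J a b x * (J b c y * J c a z)))"
      unfolding sum_product by (simp only: sum_distrib_left sum_distrib_right)
    also have "\<dots> = (\<Sum>x\<in>UNIV. \<Sum>y\<in>UNIV. \<Sum>z\<in>UNIV. F (x, y, z) * \<chi> (r (x, y, z)))"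
    proof (rule sum.cong[OF refl], rule sum.cong[OF refl], rule sum.cong[OF refl])
      fix x y z
      have "\<chi> (- (x * y * z)) = \<chi> (-1) * (\<chi> x * \<chi> y * \<chi> z)"
        using mult_chars_minus[OF \<chi>, of "x * y * z"] by (simp add: mult_chars_mult[OF \<chi>])
      then have "\<chi> (r (x, y, z)) =
          \<chi> (-1) * (\<chi> x * \<chi> y * \<chi> z) / (\<chi> (1 - x) * \<chi> (1 - y) * \<chi> (1 - z))"
        unfolding r_def prod.case mult_chars_divide[OF \<chi>] by (simp add: mult_chars_mult[OF \<chi>])
      then show "\<chi> (-1) * (J a b x * (J b c y * J c a z)) = F (x, y, z) * \<chi> (r (x, y, z))"
        using abc by (simp add: J_def F_def mult_chars_mult) (simp add: mult_ac)
    qed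
    also have "\<dots> = (\<Sum>s\<in>UNIV. F s * \<chi> (r s))"
      by (subst sum_UNIV_triple) simp
    finally show ?thesis .
  qed
  have e1: "wp_sum a b c = g (a * b) * g (b * c) * g (a * c) *
      (\<Sum>\<chi>\<in>mult_chars. \<Sum>s\<in>UNIV. F s * \<chi> (r s))"
    unfolding wp_sum_def by (subst sum_distrib_left) (rule sum.cong[OF refl], rule summand)
  have "(\<Sum>\<chi>\<in>mult_chars. \<Sum>s\<in>UNIV. F s * \<chi> (r s)) =
      (\<Sum>s\<in>UNIV. F s * (\<Sum>\<chi>\<in>mult_chars. \<chi> (r s)))"
    by (subst sum.swap) (simp only: sum_distrib_left)
  also have "\<dots> = (\<Sum>s\<in>UNIV. if s \<in> jacobi_surface then (of_nat CARD('a) - 1) * F s else 0)"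
    by (rule sum.cong[OF refl]) (simp add: sum_mult_chars_orthogonal r)
  also have "\<dots> = (of_nat CARD('a) - 1) * (\<Sum>s\<in>jacobi_surface. F s)"
    by (simp add: sum.If_cases sum_distrib_left)
  finally have e2: "(\<Sum>\<chi>\<in>mult_chars. \<Sum>s\<in>UNIV. F s * \<chi> (r s)) =
      (of_nat CARD('a) - 1) * (\<Sum>s\<in>jacobi_surface. F s)" .
  have e3: "(\<Sum>s\<in>jacobi_surface. F s) =
      (\<Sum>u\<in>UNIV. \<Sum>v\<in>UNIV. a u * b v * c (1 - u - v)) +
      \<phi> (-1) * (\<Sum>u\<in>UNIV. \<Sum>v\<in>UNIV. (a * \<phi>) u * (b * \<phi>) v * (c * \<phi>) (1 - u - v))"
    unfolding F_def \<phi>_def by (rule sum_jacobi_surface[OF odd abc nt])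
  have e4: "(\<Sum>u\<in>UNIV. \<Sum>v\<in>UNIV. a u * b v * c (1 - u - v)) = g a * g b * g c / g (a * b * c)"
    using gauss_sum_mult_jacobi3[OF abc ntt(1)] gauss_sum_nz[of "a * b * c"] abc
    by (simp add: mult_chars_times_closed)
  have e5: "(\<Sum>u\<in>UNIV. \<Sum>v\<in>UNIV. (a * \<phi>) u * (b * \<phi>) v * (c * \<phi>) (1 - u - v)) =
      g (a * \<phi>) * g (b * \<phi>) * g (c * \<phi>) / g (a * b * c * \<phi>)"
  proof -
    \<comment> \<open>Of the three factors \<phi> two cancel, which leaves the single one in the
      denominator of \<open>wp_value\<close>.\<close>
    have "a * \<phi> * (b * \<phi>) * (c * \<phi>) = (\<phi> * \<phi>) * (a * b * c * \<phi>)" by (simp only: mult_ac)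
    also have "\<dots> = a * b * c * \<phi>"
      unfolding \<phi>(2) by (rule triv_char_mult) (use abc \<phi> in blast)
    finally have *: "a * \<phi> * (b * \<phi>) * (c * \<phi>) = a * b * c * \<phi>" .
    have mem: "a * \<phi> \<in> mult_chars" "b * \<phi> \<in> mult_chars" "c * \<phi> \<in> mult_chars" "a * b * c * \<phi> \<in> mult_chars"
      using abc \<phi> by blast+
    have "a * \<phi> * (b * \<phi>) * (c * \<phi>) \<noteq> triv_char" using ntt(2) unfolding * by (simp add: \<phi>_def)
    note jac3 = gauss_sum_mult_jacobi3[OF mem(1-3) this, unfolded *]
    show ?thesis
      by (simp only: jac3 nonzero_mult_div_cancel_left[OF gauss_sum_nz[OF mem(4)]])
  qed
  show ?thesis
    unfolding e1 e2 e3 e4 e5 wp_value_def \<phi>_def[symmetric] by (simp add: mult_ac)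
qed

text \<open>After both Gauss sums are expanded, orthogonality keeps only the pairs
  \<open>(t, - t)\<close>. There the additive characters cancel, and \<open>c t * c (- t)\<close>
  sums to 0.\<close>

lemma sum_gauss_sum_pair:
  assumes c: "c \<in> mult_chars" and cc: "c * c \<noteq> triv_char"
  shows "(\<Sum>\<chi>\<in>mult_chars. \<chi> (-1) * (g (c * \<chi>) * g (c * inverse \<chi>))) = 0"
proof -
  let ?q = "of_nat CARD('a) :: complex"
  define f where "f s = c (fst s) * c (snd s) * (\<theta> (fst s) * \<theta> (snd s))" for s
  have summand: "\<chi> (-1) * (g (c * \<chi>) * g (c * inverse \<chi>)) = (\<Sum>s\<in>UNIV. f s * \<chi> (- fst s / snd s))"
    if \<chi>: "\<chi> \<in> mult_chars" for \<chi>
  proof -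
    have "f (x, y) * \<chi> (- x / y) = \<chi> (-1) * ((c * \<chi>) x * \<theta> x * ((c * inverse \<chi>) y * \<theta> y))" for x y
      using mult_chars_minus[OF \<chi>, of x]
      by (simp only: f_def mult_chars_divide[OF \<chi>]) (simp add: field_simps)
    note eq = this
    have "\<chi> (-1) * (g (c * \<chi>) * g (c * inverse \<chi>)) =
        (\<Sum>x\<in>UNIV. \<Sum>y\<in>UNIV. \<chi> (-1) * ((c * \<chi>) x * \<theta> x * ((c * inverse \<chi>) y * \<theta> y)))"
      unfolding gauss_sum_def sum_product by (simp only: sum_distrib_left)
    also have "\<dots> = (\<Sum>x\<in>UNIV. \<Sum>y\<in>UNIV. f (x, y) * \<chi> (- x / y))"
      by (simp only: eq)
    also have "\<dots> = (\<Sum>s\<in>UNIV. f s * \<chi> (- fst s / snd s))"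
      unfolding sum.cartesian_product UNIV_Times_UNIV split_def by simp
    finally show ?thesis .
  qed
  have "(\<Sum>\<chi>\<in>mult_chars. \<chi> (-1) * (g (c * \<chi>) * g (c * inverse \<chi>))) =
      (\<Sum>\<chi>\<in>mult_chars. \<Sum>s\<in>UNIV. f s * \<chi> (- fst s / snd s))"
    by (rule sum.cong[OF refl]) (rule summand)
  also have "\<dots> = (\<Sum>s\<in>UNIV. f s * (\<Sum>\<chi>\<in>mult_chars. \<chi> (- fst s / snd s)))"
    by (subst sum.swap) (simp only: sum_distrib_left)
  also have "\<dots> = (\<Sum>s\<in>(\<lambda>t. (t, - t)) ` (- {0}). (?q - 1) * f s)"
  proof (rule sum.mono_neutral_cong_right)
    show "\<forall>s\<in>UNIV - (\<lambda>t. (t, - t)) ` (- {0}). f s * (\<Sum>\<chi>\<in>mult_chars. \<chi> (- fst s / snd s)) = 0"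
    proof
      fix s :: "'a \<times> 'a" assume s: "s \<in> UNIV - (\<lambda>t. (t, - t)) ` (- {0})"
      have "- fst s / snd s \<noteq> 1"
      proof
        assume "- fst s / snd s = 1"
        then have "snd s \<noteq> 0" "snd s = - fst s" unfolding divide_eq_1_iff by simp_all
        then have "s = (fst s, - fst s)" "fst s \<in> - {0}" by (auto simp: prod_eq_iff)
        then show False using s by blast
      qed
      then show "f s * (\<Sum>\<chi>\<in>mult_chars. \<chi> (- fst s / snd s)) = 0"
        by (simp add: sum_mult_chars_orthogonal)
    qed
  qed (auto simp: sum_mult_chars_orthogonal)
  also have "\<dots> = (?q - 1) * (\<Sum>t\<in>- {0}. c t * c (- t))"
    by (subst sum.reindex) (auto simp: inj_on_def f_def sum_distrib_left add_char_zero simp flip: add_char_add)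
  finally show ?thesis
    by (simp only: sum_mult_char_antidiagonal[OF c c cc] mult_zero_right)
qed

text \<open>Since \<open>b\<close> is the inverse of \<open>a\<close>, the reflection formula
  evaluates \<open>g (a * \<chi>) * g (b * inverse \<chi>)\<close> and its companion. The main terms
  add up to the vanishing sum of \<open>sum_gauss_sum_pair\<close>; only corrections at \<chi> equal
  to \<open>a\<close> or \<open>b\<close> remain.\<close>

lemma wp_sum_degenerate:
  assumes odd: "odd CARD('a)" and abc: "a \<in> mult_chars" "b \<in> mult_chars" "c \<in> mult_chars"
    and ab: "a * b = triv_char" and cc: "c * c \<noteq> triv_char"
  shows "wp_sum a b c = wp_value a b c"
proof -
  let ?q = "of_nat CARD('a) :: complex"
  define \<phi> :: "'a \<Rightarrow> complex" where "\<phi> = quad_char"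
  have \<phi>: "\<phi> \<in> mult_chars" "\<phi> * \<phi> = triv_char"
    using quad_char_closed[OF odd] quad_char_square[OF odd] by (simp_all add: \<phi>_def)
  have b: "b = inverse a" using ab mult_eq_triv_char_iff[OF abc(1,2)] by simp
  have a1: "a (-1) * a (-1) = 1" by (rule mult_chars_minus_one_square[OF abc(1)])
  have \<phi>1: "\<phi> (-1) * \<phi> (-1) = 1" by (rule mult_chars_minus_one_square[OF \<phi>(1)])
  define K where "K \<chi> = g (c * \<chi>) * g (c * inverse \<chi>)" for \<chi>
  have Ka: "K a = g (a * c) * g (b * c)" and Kb: "K b = g (a * c) * g (b * c)"
    by (simp_all add: K_def b inverse_fun_inverse mult_ac)
  \<comment> \<open>The product of two reflection formulas: main term, two cross terms, and the
    product of both corrections, which occurs only if \<open>a = b\<close>.\<close>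
  have summand: "\<chi> (-1) * (g (a * \<chi>) * g (a * inverse \<chi>)) * (g (b * \<chi>) * g (b * inverse \<chi>)) *
      (g (c * \<chi>) * g (c * inverse \<chi>)) =
      ?q\<^sup>2 * (\<chi> (-1) * K \<chi>) - ?q * (?q - 1) * a (-1) * ((if \<chi> = b then K \<chi> else 0) + (if \<chi> = a then K \<chi> else 0))
      + (?q - 1)\<^sup>2 * (if \<chi> = a then if a = b then a (-1) * K \<chi> else 0 else 0)" if \<chi>: "\<chi> \<in> mult_chars" for \<chi>
  proof -
    have 1: "g (a * \<chi>) * g (b * inverse \<chi>) = ?q * (a (-1) * \<chi> (-1)) - (if \<chi> = b then ?q - 1 else 0)"
      using gauss_sum_mult_inverse[OF mult_chars_times_closed[OF abc(1) \<chi>]] abc \<chi> mult_eq_triv_char_iff[OF abc(1) \<chi>]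
      by (auto simp: b inverse_fun_mult)
    have "a * inverse \<chi> = triv_char \<longleftrightarrow> \<chi> = a"
      using mult_eq_triv_char_iff[OF abc(1) mult_chars_inverse_closed[OF \<chi>]]
        inverse_fun_inverse[of a] inverse_fun_inverse[of \<chi>] by metis
    then have 2: "g (a * inverse \<chi>) * g (b * \<chi>) = ?q * (a (-1) * \<chi> (-1)) - (if \<chi> = a then ?q - 1 else 0)"
      using gauss_sum_mult_inverse[OF mult_chars_times_closed[OF abc(1) mult_chars_inverse_closed[OF \<chi>]]] abc \<chi> mult_chars_minus_one_inverse[OF \<chi>]
      by (auto simp: b inverse_fun_mult inverse_fun_inverse)
    have s: "\<chi> (-1) * \<chi> (-1) = 1" by (rule mult_chars_minus_one_square[OF \<chi>])
    have "\<chi> (-1) * (g (a * \<chi>) * g (a * inverse \<chi>)) * (g (b * \<chi>) * g (b * inverse \<chi>)) *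
      (g (c * \<chi>) * g (c * inverse \<chi>)) =
      \<chi> (-1) * (g (a * \<chi>) * g (b * inverse \<chi>)) * (g (a * inverse \<chi>) * g (b * \<chi>)) * K \<chi>"
      by (simp add: K_def mult_ac)
    also have "\<dots> = ?q\<^sup>2 * (\<chi> (-1) * K \<chi>) - ?q * (?q - 1) * a (-1) * ((if \<chi> = b then K \<chi> else 0) + (if \<chi> = a then K \<chi> else 0))
      + (?q - 1)\<^sup>2 * (if \<chi> = a then if a = b then a (-1) * K \<chi> else 0 else 0)"
    proof -
      have alg: "s * (Q * (\<alpha> * s) - D) * (Q * (\<alpha> * s) - D') * k =
          Q\<^sup>2 * (s * k) - Q * \<alpha> * (D + D') * k + s * D * D' * k"
        if "s * s = 1" "\<alpha> * \<alpha> = 1" for s Q \<alpha> D D' k :: complex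
        using that by Groebner_Basis.algebra
      show ?thesis
        unfolding 1 2 alg[OF s a1]
        by (cases "\<chi> = a"; cases "\<chi> = b") (auto simp: power2_eq_square algebra_simps)
    qed
    finally show ?thesis .
  qed
  have wp: "wp_sum a b c = ?q\<^sup>2 * (\<Sum>\<chi>\<in>mult_chars. \<chi> (-1) * K \<chi>) -
      ?q * (?q - 1) * a (-1) * ((\<Sum>\<chi>\<in>mult_chars. if \<chi> = b then K \<chi> else 0) + (\<Sum>\<chi>\<in>mult_chars. if \<chi> = a then K \<chi> else 0))
      + (?q - 1)\<^sup>2 * (\<Sum>\<chi>\<in>mult_chars. if \<chi> = a then if a = b then a (-1) * K \<chi> else 0 else 0)"
    unfolding wp_sum_def sum_distrib_left sum.distrib[symmetric] sum_subtractf[symmetric]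
    by (rule sum.cong[OF refl]) (rule summand)
  have s1: "(\<Sum>\<chi>\<in>mult_chars. \<chi> (-1) * K \<chi>) = 0"
    unfolding K_def by (rule sum_gauss_sum_pair[OF abc(3) cc])
  have s2: "(\<Sum>\<chi>\<in>mult_chars. if \<chi> = b then K \<chi> else 0) = g (a * c) * g (b * c)"
    using abc Kb by (simp add: finite_mult_chars)
  have s3: "(\<Sum>\<chi>\<in>mult_chars. if \<chi> = a then K \<chi> else 0) = g (a * c) * g (b * c)"
    using abc Ka by (simp add: finite_mult_chars)
  have s4: "(\<Sum>\<chi>\<in>mult_chars. if \<chi> = a then if a = b then a (-1) * K \<chi> else 0 else 0) =
      (if a = b then a (-1) else 0) * (g (a * c) * g (b * c))"
    using abc Ka by (cases "a = b") (simp_all add: finite_mult_chars)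
  have "Q\<^sup>2 * 0 - Q * (Q - 1) * \<alpha> * (G + G) + (Q - 1)\<^sup>2 * (D * G) =
      - (Q - 1) * G * (2 * Q * \<alpha> - (Q - 1) * D)" for Q \<alpha> G D :: complex
    by Groebner_Basis.algebra
  then have W: "wp_sum a b c = - (?q - 1) * (g (a * c) * g (b * c)) *
      (2 * ?q * a (-1) - (?q - 1) * (if a = b then a (-1) else 0))"
    unfolding wp s1 s2 s3 s4 .
  have gab: "g a * g b = ?q * a (-1) - (if a = triv_char then ?q - 1 else 0)"
    using gauss_sum_mult_inverse[OF abc(1)] by (simp add: b)
  have inv\<phi>: "inverse \<phi> = \<phi>" using mult_eq_triv_char_iff[OF \<phi>(1) \<phi>(1)] \<phi>(2) by simp
  have "a * \<phi> = triv_char \<longleftrightarrow> a = \<phi>"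
    using mult_eq_triv_char_iff[OF \<phi>(1) abc(1)] by (simp add: inv\<phi> mult.commute)
  then have gab\<phi>: "g (a * \<phi>) * g (b * \<phi>) = ?q * (a (-1) * \<phi> (-1)) - (if a = \<phi> then ?q - 1 else 0)"
    using gauss_sum_mult_inverse[OF mult_chars_times_closed[OF abc(1) \<phi>(1)]] abc \<phi> by (auto simp: b inverse_fun_mult inv\<phi>)
  have nz: "g c \<noteq> 0" "g (c * \<phi>) \<noteq> 0" using abc \<phi> by (auto intro!: gauss_sum_nz)
  have abc': "a * b * c = c" using ab triv_char_mult[OF abc(3)] by simp
  \<comment> \<open>The sign comes from \<open>g (a * b) = -1\<close>; the factors
    \<open>g c\<close> and \<open>g (c * \<phi>)\<close> cancel against the denominators, as
    \<open>a * b * c = c\<close>.\<close>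
  have v1: "wp_value a b c =
      - ((?q - 1) * (g (a * c) * g (b * c)) * (g a * g b + \<phi> (-1) * (g (a * \<phi>) * g (b * \<phi>))))"
    unfolding wp_value_def abc' unfolding ab gauss_sum_triv \<phi>_def[symmetric] using nz by (simp add: mult_ac)
  have v2: "g a * g b + \<phi> (-1) * (g (a * \<phi>) * g (b * \<phi>)) =
      2 * ?q * a (-1) - (?q - 1) * ((if a = triv_char then 1 else 0) + (if a = \<phi> then \<phi> (-1) else 0))"
    unfolding gab gab\<phi> using \<phi>1 by (auto simp: algebra_simps)
  \<comment> \<open>The coincidence \<open>a = b\<close> means that \<open>a\<close> has trivial
    square, and the only such characters are the trivial and the quadratic one.\<close>
  have v3: "(if a = triv_char then 1 else 0) + (if a = \<phi> then \<phi> (-1) else 0) = (if a = b then a (-1) else 0)"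
  proof -
    have "a = b \<longleftrightarrow> a * a = triv_char" using b mult_eq_triv_char_iff[OF abc(1) abc(1)] by simp
    also have "\<dots> \<longleftrightarrow> a ^ 2 = triv_char ^ 2"
      by (simp add: power2_eq_square triv_char_mult)
    also have "\<dots> \<longleftrightarrow> a \<in> {triv_char, triv_char * \<phi>}"
      using mult_chars_square_roots(1)[OF odd triv_char_closed] abc(1) unfolding \<phi>_def by blast
    also have "\<dots> \<longleftrightarrow> a = triv_char \<or> a = \<phi>" using triv_char_mult[OF \<phi>(1)] by simp
    finally have "a = b \<longleftrightarrow> a = triv_char \<or> a = \<phi>" .
    moreover have "triv_char \<noteq> \<phi>"
      using mult_chars_square_roots(2)[OF odd triv_char_closed] triv_char_mult[OF \<phi>(1)] by (simp add: \<phi>_def)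
    moreover have "triv_char (-1 :: 'a) = 1" by (simp add: triv_char_def)
    ultimately show ?thesis by auto
  qed
  show ?thesis unfolding W v1 v2 v3 by (simp only: minus_mult_left)
qed

text \<open>The hypothesis serves all cases. If two characters have trivial product, it says that
  the third has nontrivial square; otherwise it keeps \<open>a * b * c\<close> away from both the
  trivial and the quadratic character.\<close>

lemma wp_sum_eq:
  assumes odd: "odd CARD('a)" and abc: "a \<in> mult_chars" "b \<in> mult_chars" "c \<in> mult_chars"
    and nt: "(a * b * c) ^ 2 \<noteq> triv_char"
  shows "wp_sum a b c = wp_value a b c"
proof -
  have deg: "z * z \<noteq> triv_char" if "x * y = triv_char" "x * y * z = a * b * c" "z \<in> mult_chars" for x y z
    using that nt triv_char_mult[of z] by (simp add: power2_eq_square)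
  consider "a * b = triv_char" | "b * c = triv_char" | "a * c = triv_char" |
    "a * b \<noteq> triv_char" "b * c \<noteq> triv_char" "a * c \<noteq> triv_char" by blast
  then show ?thesis
  proof cases
    case 1
    show ?thesis by (rule wp_sum_degenerate[OF odd abc 1 deg[OF 1 refl abc(3)]])
  next
    case 2
    have "b * c * a = a * b * c" by (simp add: mult_ac)
    then have "wp_sum b c a = wp_value b c a"
      by (rule wp_sum_degenerate[OF odd abc(2,3,1) 2 deg[OF 2 _ abc(1)]])
    then show ?thesis by (metis wp_sum_commute wp_value_commute)
  next
    case 3
    have "a * c * b = a * b * c" by (simp add: mult_ac)
    then have "wp_sum a c b = wp_value a c b"
      by (rule wp_sum_degenerate[OF odd abc(1,3,2) 3 deg[OF 3 _ abc(2)]])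
    then show ?thesis by (metis wp_sum_commute wp_value_commute)
  next
    case 4
    have "a * b * c \<noteq> triv_char"
      using nt by (auto simp: power2_eq_square triv_char_mult)
    moreover have "a * b * c * quad_char \<noteq> triv_char"
    proof
      assume *: "a * b * c * quad_char = triv_char"
      have "(a * b * c) ^ 2 = (quad_char * quad_char) * (a * b * c) ^ 2"
        using abc triv_char_mult[of "(a * b * c) * (a * b * c)"]
        by (simp add: quad_char_square[OF odd] power2_eq_square mult_chars_times_closed)
      also have "\<dots> = (a * b * c * quad_char) * (a * b * c * quad_char)"
        by (simp add: power2_eq_square mult_ac)
      also have "\<dots> = triv_char" by (simp add: * triv_char_mult)
      finally show False using nt by simp
    qed
    ultimately show ?thesis using wp_sum_generic[OF odd abc] 4 by blast
  qed
qed

end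

section \<open>Reduction of the hypergeometric sum to the well-poised sum\<close>

lemma mult_chars_power2: "R \<in> mult_chars \<Longrightarrow> R ^ 2 \<in> mult_chars"
  by (simp add: power2_eq_square mult_chars_times_closed)

lemma power2_fun_apply: "(f ^ 2) x = f x * (f x :: complex)"
  by (simp add: power2_eq_square)

context nontrivial_add_char
begin

lemma gauss_sum_inverse:
  assumes "\<chi> \<in> mult_chars" "\<chi> \<noteq> triv_char"
  shows "g (inverse \<chi>) = of_nat CARD('a) * \<chi> (-1) / g \<chi>"
  using gauss_sum_mult_inverse[OF assms(1)] gauss_sum_nz[OF assms(1)] assms(2)
  by (simp add: field_simps)

lemma hyp3F2_nonsquare:
  assumes odd: "odd CARD('a)" and ABC: "A \<in> mult_chars" "B \<in> mult_chars" "C \<in> mult_chars"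
    and "\<not> is_square_char A"
  shows "hyp3F2 \<theta> A B C (A * inverse B) (A * inverse C) 1 = 0"
proof -
  define f where "f \<chi> = gauss_sum \<theta> (A * \<chi>) / gauss_sum \<theta> A *
        (gauss_sum \<theta> (B * \<chi>) / gauss_sum \<theta> B) *
        (gauss_sum \<theta> (C * \<chi>) / gauss_sum \<theta> C) *
        (gauss_sum \<theta> (inverse (A * inverse B * \<chi>)) / gauss_sum \<theta> (inverse (A * inverse B))) *
        (gauss_sum \<theta> (inverse (A * inverse C * \<chi>)) / gauss_sum \<theta> (inverse (A * inverse C))) *
        gauss_sum \<theta> (inverse \<chi>) * \<chi> (-1) * \<chi> 1" for \<chi>
  have "f (inverse (A * \<chi>)) = - f \<chi>" if \<chi>: "\<chi> \<in> mult_chars" for \<chi>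
  proof -
    define \<psi> where "\<psi> = inverse (A * \<chi>)"
    \<comment> \<open>The involution swaps the six Gauss sums in pairs, so only the factor at -1
      changes, by \<open>A (-1) = -1\<close>.\<close>
    have eqs: "A * \<psi> = inverse \<chi>" "inverse \<psi> = A * \<chi>"
      "B * \<psi> = inverse (A * inverse B * \<chi>)" "inverse (A * inverse B * \<psi>) = B * \<chi>"
      "C * \<psi> = inverse (A * inverse C * \<chi>)" "inverse (A * inverse C * \<psi>) = C * \<chi>"
      using ABC \<chi> by (auto simp: \<psi>_def fun_eq_iff mult_chars_eq_0_iff field_simps)
    have "\<psi> (-1) = - \<chi> (-1)" "\<psi> 1 = 1"
      using mult_char_minus_one_nonsquare[OF odd ABC(1) assms(5)] mult_chars_minus_one_inverse[OF \<chi>]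
        mult_chars_one[OF ABC(1)] mult_chars_one[OF \<chi>]
      by (simp_all add: \<psi>_def)
    then have "f \<psi> = - f \<chi>"
      unfolding f_def eqs using mult_chars_one[OF \<chi>] by (simp add: mult_ac)
    then show ?thesis by (simp add: \<psi>_def)
  qed
  then have "(\<Sum>\<chi>\<in>mult_chars. f (inverse (A * \<chi>))) = - (\<Sum>\<chi>\<in>mult_chars. f \<chi>)"
    by (simp add: sum_negf)
  moreover have "(\<Sum>\<chi>\<in>mult_chars. f (inverse (A * \<chi>))) = (\<Sum>\<chi>\<in>mult_chars. f \<chi>)"
    using sum_mult_chars_shift[OF ABC(1), of "\<lambda>\<chi>. f (inverse \<chi>)"] sum_mult_chars_inverse[of f] by simp
  ultimately have "(\<Sum>\<chi>\<in>mult_chars. f \<chi>) = 0" by simp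
  then show ?thesis unfolding hyp3F2_def f_def by simp
qed

lemma hyp3F2_square:
  assumes odd: "odd CARD('a)" and RBC: "R \<in> mult_chars" "B \<in> mult_chars" "C \<in> mult_chars"
    and nt: "R ^ 2 \<noteq> triv_char" "(B * C) ^ 2 \<noteq> R ^ 2"
  shows "hyp3F2 \<theta> (R ^ 2) B C (R ^ 2 * inverse B) (R ^ 2 * inverse C) 1 =
     (\<Sum>S | S \<in> mult_chars \<and> S ^ 2 = R ^ 2.
       (g (inverse (R ^ 2)) * g (inverse S * B) * g (inverse S * C) * g (inverse (R ^ 2) * B * C)) /
       (g (inverse S) * g (inverse (R ^ 2) * B) * g (inverse (R ^ 2) * C) * g (inverse S * B * C)))"
proof -
  let ?q = "of_nat CARD('a) :: complex"
  define A where "A = R ^ 2"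
  have A: "A \<in> mult_chars" using RBC by (simp add: A_def mult_chars_power2)
  have Ax: "A x = R x * R x" for x by (simp add: A_def power2_fun_apply)
  define \<phi> :: "'a \<Rightarrow> complex" where "\<phi> = quad_char"
  have \<phi>: "\<phi> \<in> mult_chars" "\<phi> * \<phi> = triv_char"
    using quad_char_closed[OF odd] quad_char_square[OF odd] by (simp_all add: \<phi>_def)
  have inv\<phi>: "inverse \<phi> = \<phi>" using mult_eq_triv_char_iff[OF \<phi>(1) \<phi>(1)] \<phi>(2) by simp
  \<comment> \<open>After the shift by \<open>inverse R\<close> the six Gauss sums become symmetric
    under inversion of \<chi>, with parameters \<open>R\<close>, \<open>b\<close>,
    \<open>c\<close>.\<close>
  define b where "b = inverse R * B"
  define c where "c = inverse R * C"
  have bc: "b \<in> mult_chars" "c \<in> mult_chars" using RBC by (auto simp: b_def c_def)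
  have eqs: "R * b = B" "R * c = C" "b * c = inverse A * B * C" "R * b * c = inverse R * B * C"
    using RBC by (auto simp: b_def c_def Ax fun_eq_iff mult_chars_eq_0_iff field_simps)
  define N where "N = g A * g B * g C * g (inverse A * B) * g (inverse A * C)"
  have nz: "g A \<noteq> 0" "g B \<noteq> 0" "g C \<noteq> 0" "g (inverse A * B) \<noteq> 0" "g (inverse A * C) \<noteq> 0"
    using A RBC by (auto intro!: gauss_sum_nz)
  have inv: "inverse (A * inverse B) = inverse A * B" "inverse (A * inverse C) = inverse A * C"
    by (simp_all add: inverse_fun_mult inverse_fun_inverse)
  have R1: "R (-1) * R (-1) = 1" by (rule mult_chars_minus_one_square[OF RBC(1)])
  have "hyp3F2 \<theta> A B C (A * inverse B) (A * inverse C) 1 = 1 / (?q - 1) *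
      (\<Sum>\<chi>\<in>mult_chars. g (A * \<chi>) * g (B * \<chi>) * g (C * \<chi>) * g (inverse (A * inverse B * \<chi>)) *
        g (inverse (A * inverse C * \<chi>)) * g (inverse \<chi>) * \<chi> (-1) / N)"
    unfolding hyp3F2_def inv N_def
    by (intro arg_cong2[where f = "(*)"] refl sum.cong) (simp add: mult_chars_one mult_ac)
  also have "\<dots> = 1 / (?q - 1) *
      (\<Sum>\<chi>\<in>mult_chars. g (A * (inverse R * \<chi>)) * g (B * (inverse R * \<chi>)) * g (C * (inverse R * \<chi>)) *
        g (inverse (A * inverse B * (inverse R * \<chi>))) * g (inverse (A * inverse C * (inverse R * \<chi>))) *
        g (inverse (inverse R * \<chi>)) * (inverse R * \<chi>) (-1) / N)"
    by (subst sum_mult_chars_shift[OF mult_chars_inverse_closed[OF RBC(1)], symmetric]) (rule refl)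
  also have "\<dots> = 1 / (?q - 1) * (\<Sum>\<chi>\<in>mult_chars. R (-1) / N * (\<chi> (-1) * (g (R * \<chi>) * g (R * inverse \<chi>)) *
     (g (b * \<chi>) * g (b * inverse \<chi>)) * (g (c * \<chi>) * g (c * inverse \<chi>))))"
  proof (intro arg_cong2[where f = "(*)"] refl sum.cong)
    fix \<chi> :: "'a \<Rightarrow> complex" assume \<chi>: "\<chi> \<in> mult_chars"
    have "A * (inverse R * \<chi>) = R * \<chi>" "B * (inverse R * \<chi>) = b * \<chi>" "C * (inverse R * \<chi>) = c * \<chi>"
      "inverse (A * inverse B * (inverse R * \<chi>)) = b * inverse \<chi>"
      "inverse (A * inverse C * (inverse R * \<chi>)) = c * inverse \<chi>"
      "inverse (inverse R * \<chi>) = R * inverse \<chi>"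
      using RBC \<chi> by (auto simp: b_def c_def Ax fun_eq_iff mult_chars_eq_0_iff field_simps)
    moreover have "(inverse R * \<chi>) (-1) = R (-1) * \<chi> (-1)"
      using mult_chars_minus_one_inverse[OF RBC(1)] by simp
    ultimately show "g (A * (inverse R * \<chi>)) * g (B * (inverse R * \<chi>)) * g (C * (inverse R * \<chi>)) *
        g (inverse (A * inverse B * (inverse R * \<chi>))) * g (inverse (A * inverse C * (inverse R * \<chi>))) *
        g (inverse (inverse R * \<chi>)) * (inverse R * \<chi>) (-1) / N =
        R (-1) / N * (\<chi> (-1) * (g (R * \<chi>) * g (R * inverse \<chi>)) *
        (g (b * \<chi>) * g (b * inverse \<chi>)) * (g (c * \<chi>) * g (c * inverse \<chi>)))"
      by (simp only:) (simp add: mult_ac)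
  qed
  also have "\<dots> = R (-1) / N / (?q - 1) * wp_sum R b c"
    unfolding wp_sum_def sum_distrib_left[symmetric] by (simp add: mult_ac)
  also have "wp_sum R b c = wp_value R b c"
  proof (rule wp_sum_eq[OF odd RBC(1) bc])
    show "(R * b * c)\<^sup>2 \<noteq> triv_char"
    proof
      assume "(R * b * c)\<^sup>2 = triv_char"
      then have sq: "(inverse R * B * C) ^ 2 = triv_char" unfolding eqs(4) .
      have "B x * C x * (B x * C x) = R x * R x" for x
        using fun_cong[OF sq, of x] RBC
        by (cases "x = 0") (auto simp: power2_fun_apply triv_char_def mult_chars_eq_0_iff mult_chars_zero field_simps)
      then have "(B * C) ^ 2 = R ^ 2" by (simp add: power2_eq_square fun_eq_iff)
      then show False using nt by simp
    qed
  qed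
  finally have hyp: "hyp3F2 \<theta> A B C (A * inverse B) (A * inverse C) 1 =
     R (-1) / N / (?q - 1) * wp_value R b c" .
  define V where "V S = (g (inverse A) * g (inverse S * B) * g (inverse S * C) * g (inverse A * B * C)) /
       (g (inverse S) * g (inverse A * B) * g (inverse A * C) * g (inverse S * B * C))" for S
  have V: "V S = g (inverse A * B * C) / (g A * g (inverse A * B) * g (inverse A * C)) *
      (S (-1) * (g S * g (inverse S * B) * g (inverse S * C)) / g (inverse S * B * C))"
    \<comment> \<open>Reflection turns \<open>g (inverse A)\<close> and \<open>g (inverse S)\<close>
      into reciprocals of \<open>g A\<close> and \<open>g S\<close>. The factors \<open>?q\<close>
      cancel and \<open>A (-1) = 1\<close>, so of the signs only \<open>S (-1)\<close>
      remains.\<close>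
    if S: "S \<in> mult_chars" "S ^ 2 = A" for S
  proof -
    have "S \<noteq> triv_char"
    proof
      assume "S = triv_char"
      then have "A = triv_char" using S(2) by (simp add: power2_eq_square triv_char_mult)
      then show False using nt by (simp add: A_def)
    qed
    then have gS: "g (inverse S) = ?q * S (-1) / g S" by (rule gauss_sum_inverse[OF S(1)])
    have "A (-1) = 1" using R1 Ax by simp
    then have gA: "g (inverse A) = ?q / g A"
      using gauss_sum_inverse[OF A] nt by (simp add: A_def)
    have nzs: "g S \<noteq> 0" "g (inverse S * B * C) \<noteq> 0" "S (-1) \<noteq> 0" "?q \<noteq> 0"
      using S RBC q_neq by (auto intro!: gauss_sum_nz simp: mult_chars_eq_0_iff)
    have S1: "1 / S (-1) = S (-1)"
      using mult_chars_minus_one_inverse[OF S(1)] by (simp add: inverse_eq_divide)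
    have "V S = g (inverse A * B * C) / (g A * g (inverse A * B) * g (inverse A * C)) *
      (1 / S (-1) * (g S * g (inverse S * B) * g (inverse S * C)) / g (inverse S * B * C))"
      unfolding V_def gS gA using nz nzs by (simp add: field_simps)
    then show ?thesis unfolding S1 .
  qed
  \<comment> \<open>The two square roots match the two terms of \<open>wp_value\<close>; the sign
    \<open>\<phi> (-1)\<close> of the second comes from \<open>R * \<phi>\<close> at -1.\<close>
  have "(\<Sum>S | S \<in> mult_chars \<and> S ^ 2 = A. V S) = V R + V (R * \<phi>)"
    using mult_chars_square_roots[OF odd RBC(1)] by (simp add: A_def \<phi>_def)
  also have "\<dots> = R (-1) / N / (?q - 1) * wp_value R b c"
  proof -
    have R\<phi>: "R * \<phi> \<in> mult_chars" "(R * \<phi>) ^ 2 = A"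
      using mult_chars_square_roots(1)[OF odd RBC(1)] unfolding A_def \<phi>_def by blast+
    have eqs\<phi>: "inverse (R * \<phi>) * B = b * \<phi>" "inverse (R * \<phi>) * C = c * \<phi>"
      "inverse (R * \<phi>) * B * C = R * b * c * \<phi>"
      unfolding eqs by (simp_all add: inverse_fun_mult inv\<phi> b_def c_def mult_ac)
    have V1: "V R = g (inverse A * B * C) / (g A * g (inverse A * B) * g (inverse A * C)) *
      (R (-1) * (g R * g b * g c) / g (R * b * c))"
      using V[OF RBC(1)] unfolding eqs(4) by (simp add: A_def b_def c_def)
    have V2: "V (R * \<phi>) = g (inverse A * B * C) / (g A * g (inverse A * B) * g (inverse A * C)) *
      (R (-1) * \<phi> (-1) * (g (R * \<phi>) * g (b * \<phi>) * g (c * \<phi>)) / g (R * b * c * \<phi>))"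
      unfolding V[OF R\<phi>] unfolding eqs\<phi>(3) unfolding eqs\<phi>(1,2) by simp
    have val: "wp_value R b c = (?q - 1) * (g B * g (inverse A * B * C) * g C) *
     (g R * g b * g c / g (R * b * c) + \<phi> (-1) * (g (R * \<phi>) * g (b * \<phi>) * g (c * \<phi>)) / g (R * b * c * \<phi>))"
      unfolding wp_value_def eqs(1-3) \<phi>_def ..
    have alg: "P / (a * x * y) * (r * X1 / G1) + P / (a * x * y) * (r * f * X2 / G2) =
        r / (a * b * c * x * y) / Q * (Q * (b * P * c) * (X1 / G1 + f * X2 / G2))"
      if "b \<noteq> 0" "c \<noteq> 0" "Q \<noteq> 0" for P a x y r X1 G1 f X2 G2 b c Q :: complex
      using that by (simp add: distrib_left) (simp add: mult_ac)
    show ?thesis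
      unfolding V1 V2 val N_def by (rule alg[OF nz(2,3) q_neq(2)])
  qed
  finally have fin: "(\<Sum>S | S \<in> mult_chars \<and> S ^ 2 = A. V S) = R (-1) / N / (?q - 1) * wp_value R b c" .
  show ?thesis
    unfolding A_def[symmetric] hyp fin[symmetric] V_def by (rule refl)
qed

end

theorem theorem1p11:
  fixes \<theta> A B C :: "'a :: {field, finite} \<Rightarrow> complex"
  assumes "odd CARD('a)"
    and "\<theta> \<in> add_chars" and "\<exists>x. \<theta> x \<noteq> 1"
    and "A \<in> mult_chars" and "B \<in> mult_chars" and "C \<in> mult_chars"
    and "A \<noteq> triv_char" and "(B * C) ^ 2 \<noteq> A"
  shows "hyp3F2 \<theta> A B C (A * inverse B) (A * inverse C) 1 =
    (if \<not> is_square_char A then 0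
     else \<Sum>R | R \<in> mult_chars \<and> R ^ 2 = A.
       (gauss_sum \<theta> (inverse A) * gauss_sum \<theta> (inverse R * B) *
        gauss_sum \<theta> (inverse R * C) * gauss_sum \<theta> (inverse A * B * C)) /
       (gauss_sum \<theta> (inverse R) * gauss_sum \<theta> (inverse A * B) *
        gauss_sum \<theta> (inverse A * C) * gauss_sum \<theta> (inverse R * B * C)))"
proof -
  interpret nontrivial_add_char \<theta> by unfold_locales (use assms in auto)
  show ?thesis
  proof (cases "is_square_char A")
    case True
    then obtain R where "R \<in> mult_chars" "A = R ^ 2" by (auto simp: is_square_char_def)
    then show ?thesis using hyp3F2_square[OF assms(1) _ assms(5,6)] assms(7,8) True by simp
  next
    case False
    then show ?thesis using hyp3F2_nonsquare[OF assms(1,4-6)] by simp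
  qed
qed

end
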